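(* For each $n\ge 1$ let $U(n)$ be an $n\times n$ Haar unitary random matrix. Then $\operatorname{Tr} U(n)$ converges in distribution to a standard complex normal random variable as $n\to\infty$.
   Context: An $n\times n$ Haar unitary random matrix is a random matrix with values in the group $\mathcal U(n)$ of $n\times n$ complex unitary matrices, distributed according to the normalized Haar measure on $\mathcal U(n)$. $\operatorname{Tr}$ is the usual (unnormalized) trace. A complex-valued random variable $\xi$ is called standard complex normal if $\operatorname{Re}\xi$ and $\operatorname{Im}\xi$ are independent and each normally distributed with mean $0$ and variance $1/2$. *)

theory Defs
  imports "HOL-Probability.Probability" "Jordan_Normal_Form.Schur_Decomposition"
begin

definition unitary_group :: "nat \<Rightarrow> complex mat set" where
  "unitary_group n =
     {A \<in> carrier_mat n n. A * mat_adjoint A = 1\<^sub>m n \<and> mat_adjoint A * A = 1\<^sub>m n}"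

definition trace_mat :: "'a::comm_monoid_add mat \<Rightarrow> 'a" where
  "trace_mat A = (\<Sum>i<dim_row A. A $$ (i, i))"

(* The type of matrices carries no topology. The n x n matrices are embedded into the functions
   on nat * nat with the product topology (entries outside the n x n block set to 0). The subspace
   topology on the unitary group is the usual one; pulling back the Borel sets gives the
   Borel sigma-algebra of the unitary group. *)

definition mat_entries :: "nat \<Rightarrow> complex mat \<Rightarrow> nat \<times> nat \<Rightarrow> complex" where
  "mat_entries n A = (\<lambda>(i, j). if i < n \<and> j < n then A $$ (i, j) else 0)"

definition unitary_borel :: "nat \<Rightarrow> complex mat measure" where
  "unitary_borel n = vimage_algebra (unitary_group n) (mat_entries n) borel"

(* The (left) translation invariant Borel probability measure on the unitary group. It is unique,
   so this predicate describes the normalized Haar measure; right invariance is a consequence. *)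

definition normalized_haar_unitary :: "nat \<Rightarrow> complex mat measure \<Rightarrow> bool" where
  "normalized_haar_unitary n \<mu> \<longleftrightarrow>
     sets \<mu> = sets (unitary_borel n) \<and> prob_space \<mu> \<and>
     (\<forall>V \<in> unitary_group n. \<forall>S \<in> sets \<mu>. emeasure \<mu> ((\<lambda>A. V * A) ` S) = emeasure \<mu> S)"

definition haar_unitary_random_matrix ::
    "nat \<Rightarrow> 'a measure \<Rightarrow> ('a \<Rightarrow> complex mat) \<Rightarrow> bool" where
  "haar_unitary_random_matrix n M U \<longleftrightarrow>
     prob_space M \<and> U \<in> measurable M (unitary_borel n) \<and>
     normalized_haar_unitary n (distr M (unitary_borel n) U)"

definition standard_complex_normal :: "'a measure \<Rightarrow> ('a \<Rightarrow> complex) \<Rightarrow> bool" where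
  "standard_complex_normal M \<xi> \<longleftrightarrow>
     prob_space M \<and> \<xi> \<in> borel_measurable M \<and>
     prob_space.indep_var M borel (\<lambda>\<omega>. Re (\<xi> \<omega>)) borel (\<lambda>\<omega>. Im (\<xi> \<omega>)) \<and>
     distributed M lborel (\<lambda>\<omega>. Re (\<xi> \<omega>)) (normal_density 0 (sqrt (1 / 2))) \<and>
     distributed M lborel (\<lambda>\<omega>. Im (\<xi> \<omega>)) (normal_density 0 (sqrt (1 / 2)))"

(* The library's weak_conv_m is restricted to real-valued variables (it uses distribution
   functions), hence the definition by bounded continuous test functions. The X n and the limit
   may live on different probability spaces. *)

definition converges_in_distribution ::
    "(nat \<Rightarrow> 'a measure) \<Rightarrow> (nat \<Rightarrow> 'a \<Rightarrow> complex) \<Rightarrow> 'b measure \<Rightarrow> ('b \<Rightarrow> complex) \<Rightarrow> bool" where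
  "converges_in_distribution M X N Y \<longleftrightarrow>
     (\<forall>f :: complex \<Rightarrow> real. continuous_on UNIV f \<and> bounded (range f) \<longrightarrow>
        (\<lambda>n. \<integral>\<omega>. f (X n \<omega>) \<partial>(M n)) \<longlonglongrightarrow> (\<integral>\<omega>. f (Y \<omega>) \<partial>N))"

end

theory Submission
  imports Defs "HOL-Real_Asymp.Real_Asymp"
begin

text \<open>
  Write \<open>T = Tr U\<close> and \<open>G = exp (i Re (cnj z T))\<close>. Invariance of the Haar measure under rotations
  of rows \<open>j\<close> and \<open>k\<close>, differentiated at the identity, gives for \<open>j \<noteq> k\<close>
  \<open>E (u\<^sub>k\<^sub>k G) = i/2 E ((z \<bar>u\<^sub>j\<^sub>k\<bar>\<^sup>2 - cnj z u\<^sub>j\<^sub>k u\<^sub>k\<^sub>j) G)\<close>. Summing over all pairs, the terms \<open>\<bar>u\<^sub>j\<^sub>k\<bar>\<^sup>2\<close> add up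
  to almost \<open>n\<close>, whereas sign changes of single rows show that the second moment of the sum of the
  \<open>u\<^sub>j\<^sub>k u\<^sub>k\<^sub>j\<close> is at most \<open>2 n\<close>. Hence \<open>E (T G) = i/2 z E G + O(n\<^sup>-\<^sup>1\<^sup>/\<^sup>2)\<close>, which is up to the error the
  differential equation for the characteristic function of the standard complex normal law.
  Together with \<open>E \<bar>T\<bar>\<^sup>2 = 1\<close>, convergence of the characteristic functions implies convergence in
  distribution.
\<close>

section \<open>Trigonometric polynomials and sine truncation\<close>

text \<open>For a single pair, the expectation of the absolute value of
  \<open>u\<^sub>j\<^sub>k u\<^sub>k\<^sub>j\<close> is of order 1/n, so bounding these terms one at
  a time would give a total of order n, as large as the main term. This is why the equations of the
  single pairs are added up first and the sum is then estimated in mean square, where orthogonality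
  gains a factor of order sqrt n. Every symmetry used is left multiplication by a matrix that acts
  on two rows only: a sign change, a transposition or a rotation. The factor i/2 belongs to the
  Gaussian characteristic function exp(-|z|^2/4), whose two coordinates have variance 1/2. The
  passage from characteristic functions to continuous test functions rests on a coordinatewise
  truncation by sines: a polynomial in L sin(x/L) and L sin(y/L) is a finite sum of plane waves, so
  Weierstrass approximation on a compact ball and linearity do the work of an inversion
  formula.\<close>

lemma norm_integral_le:
  fixes f :: "'a \<Rightarrow> 'b::{banach, second_countable_topology}"
  assumes "integrable M f" "integrable M g" "\<And>x. x \<in> space M \<Longrightarrow> norm (f x) \<le> g x"
  shows "norm (\<integral>x. f x \<partial>M) \<le> (\<integral>x. g x \<partial>M)"
  by (rule order_trans[OF integral_norm_bound integral_mono]) (use assms in auto)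

text \<open>The usual definition divides the remainder by \<open>norm (s - t)\<close>, the slope by
  \<open>s - t\<close>; the difference in sign vanishes under the outer norm. Slopes along sequences
  are what dominated convergence can treat.\<close>

lemma has_vector_derivative_iff_slope:
  fixes f :: "real \<Rightarrow> 'a::real_normed_vector"
  shows "(f has_vector_derivative D) (at t) \<longleftrightarrow>
    ((\<lambda>s. (1 / (s - t)) *\<^sub>R (f s - f t)) \<longlongrightarrow> D) (at t)"
proof -
  have "((\<lambda>s. (1 / (s - t)) *\<^sub>R (f s - f t)) \<longlongrightarrow> D) (at t) \<longleftrightarrow>
      ((\<lambda>s. norm ((1 / (s - t)) *\<^sub>R (f s - f t) - D)) \<longlongrightarrow> 0) (at t)"
    by (simp only: tendsto_norm_zero_iff LIM_zero_iff)
  also have "\<dots> \<longleftrightarrow>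
      ((\<lambda>s. norm ((1 / norm (s - t)) *\<^sub>R (f s - (f t + (s - t) *\<^sub>R D)))) \<longlongrightarrow> 0) (at t)"
  proof (rule Lim_cong_within)
    fix s assume "s \<noteq> t"
    then have "(1 / (s - t)) *\<^sub>R (f s - f t) - D = (1 / (s - t)) *\<^sub>R (f s - (f t + (s - t) *\<^sub>R D))"
      by (simp add: scaleR_right_diff_distrib[of _ "f s - f t"] diff_diff_add[symmetric]
          del: diff_diff_add)
    then show "norm ((1 / (s - t)) *\<^sub>R (f s - f t) - D)
        = norm ((1 / norm (s - t)) *\<^sub>R (f s - (f t + (s - t) *\<^sub>R D)))"
      by simp
  qed auto
  also have "\<dots> \<longleftrightarrow> (f has_vector_derivative D) (at t)"
    by (simp only: tendsto_norm_zero_iff has_vector_derivative_def has_derivative_at2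
        bounded_linear_scaleR_left simp_thms)
  finally show ?thesis by simp
qed

text \<open>By the mean value inequality all difference quotients are bounded by \<open>C\<close>,
  which is integrable over a finite measure; dominated convergence then applies along every sequence
  tending to \<open>t\<close>.\<close>

lemma has_vector_derivative_lebesgue_integral:
  fixes F F' :: "real \<Rightarrow> 'a \<Rightarrow> complex"
  assumes "finite_measure M"
    and deriv: "\<And>s w. w \<in> space M \<Longrightarrow> ((\<lambda>s. F s w) has_vector_derivative F' s w) (at s)"
    and bound: "\<And>s w. w \<in> space M \<Longrightarrow> norm (F' s w) \<le> C"
    and int: "\<And>s. integrable M (F s)"
    and meas: "F' t \<in> borel_measurable M"
  shows "((\<lambda>s. \<integral>w. F s w \<partial>M) has_vector_derivative (\<integral>w. F' t w \<partial>M)) (at t)"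
proof -
  interpret finite_measure M by fact
  have "((\<lambda>s. (1 / (s - t)) *\<^sub>R ((\<integral>w. F s w \<partial>M) - (\<integral>w. F t w \<partial>M))) \<longlongrightarrow> (\<integral>w. F' t w \<partial>M)) (at t)"
  proof (subst tendsto_at_iff_sequentially, intro allI impI)
    fix X :: "nat \<Rightarrow> real"
    assume X: "\<forall>i. X i \<in> UNIV - {t}" "X \<longlonglongrightarrow> t"
    have "(\<lambda>i. \<integral>w. (1 / (X i - t)) *\<^sub>R (F (X i) w - F t w) \<partial>M) \<longlonglongrightarrow> (\<integral>w. F' t w \<partial>M)"
    proof (rule integral_dominated_convergence[where w="\<lambda>_. C"])
      show "AE w in M. (\<lambda>i. (1 / (X i - t)) *\<^sub>R (F (X i) w - F t w)) \<longlonglongrightarrow> F' t w"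
      proof (rule AE_I2)
        fix w assume w: "w \<in> space M"
        have "((\<lambda>s. (1 / (s - t)) *\<^sub>R (F s w - F t w)) \<longlongrightarrow> F' t w) (at t)"
          using deriv[OF w, of t]
          by (simp only: has_vector_derivative_iff_slope)
        then show "(\<lambda>i. (1 / (X i - t)) *\<^sub>R (F (X i) w - F t w)) \<longlonglongrightarrow> F' t w"
          using X by (simp add: tendsto_at_iff_sequentially o_def)
      qed
      show "AE w in M. norm ((1 / (X i - t)) *\<^sub>R (F (X i) w - F t w)) \<le> C" for i
      proof (rule AE_I2)
        fix w assume w: "w \<in> space M"
        have "norm (F (X i) w - F t w) \<le> C * norm (X i - t)"
          by (rule differentiable_bound[where S=UNIV and f'="\<lambda>s h. h *\<^sub>R F' s w"])
            (use deriv[OF w] bound[OF w] in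
              \<open>auto simp: has_vector_derivative_def onorm_scaleR_left onorm_id\<close>)
        moreover have "X i \<noteq> t" using X(1) by auto
        ultimately show "norm ((1 / (X i - t)) *\<^sub>R (F (X i) w - F t w)) \<le> C"
          unfolding norm_scaleR by (simp add: field_simps)
      qed
    qed (use int meas in auto)
    also have "(\<lambda>i. \<integral>w. (1 / (X i - t)) *\<^sub>R (F (X i) w - F t w) \<partial>M)
        = (\<lambda>s. (1 / (s - t)) *\<^sub>R ((\<integral>w. F s w \<partial>M) - (\<integral>w. F t w \<partial>M))) \<circ> X"
      using int by (auto simp: o_def)
    finally show "((\<lambda>s. (1 / (s - t)) *\<^sub>R ((\<integral>w. F s w \<partial>M) - (\<integral>w. F t w \<partial>M))) \<circ> X)
        \<longlonglongrightarrow> (\<integral>w. F' t w \<partial>M)" .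
  qed
  then show ?thesis
    by (simp only: has_vector_derivative_iff_slope)
qed

text \<open>\<open>Re (cnj z * w)\<close> is the inner product of \<open>z\<close> and
  \<open>w\<close> as vectors of the real plane, so the expectation of \<open>plane_wave z\<close>
  is the characteristic function at \<open>z\<close>.\<close>

definition plane_wave :: "complex \<Rightarrow> complex \<Rightarrow> complex" where
  "plane_wave z w = cis (Re (cnj z * w))"

lemma norm_plane_wave [simp]: "norm (plane_wave z w) = 1"
  by (simp add: plane_wave_def)

lemma plane_wave_mult: "plane_wave y w * plane_wave z w = plane_wave (y + z) w"
  by (simp add: plane_wave_def cis_mult algebra_simps)

lemma plane_wave_0 [simp]: "plane_wave 0 w = 1"
  by (simp add: plane_wave_def)

lemma borel_measurable_plane_wave [measurable]: "plane_wave z \<in> borel_measurable borel"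
  by (intro borel_measurable_continuous_onI) (unfold plane_wave_def, intro continuous_intros)

lemma has_vector_derivative_plane_wave:
  assumes "(f has_vector_derivative f') (at s)"
  shows "((\<lambda>s. plane_wave z (f s)) has_vector_derivative
    \<i> * Re (cnj z * f') * plane_wave z (f s)) (at s)"
proof -
  have "bounded_linear (\<lambda>x. \<i> * complex_of_real (Re (cnj z * x)))"
    by (intro bounded_linear_const_mult bounded_linear_compose[OF bounded_linear_of_real]
        bounded_linear_compose[OF bounded_linear_Re] bounded_linear_mult_right)
  then have "((\<lambda>s. \<i> * complex_of_real (Re (cnj z * f s))) has_vector_derivative
      \<i> * complex_of_real (Re (cnj z * f'))) (at s)"
    using assms by (rule bounded_linear.has_vector_derivative)
  from field_vector_diff_chain_at[OF this DERIV_exp] show ?thesis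
    by (simp add: plane_wave_def cis_conv_exp o_def)
qed

text \<open>Convergence of characteristic functions extends to this class by linearity. Since
  frequencies add under multiplication, it is an algebra.\<close>

inductive trig_poly :: "(complex \<Rightarrow> complex) \<Rightarrow> bool" where
  wave: "trig_poly (\<lambda>w. c * plane_wave z w)"
| add: "trig_poly f \<Longrightarrow> trig_poly g \<Longrightarrow> trig_poly (\<lambda>w. f w + g w)"

lemma trig_poly_wave_mult:
  assumes "trig_poly g"
  shows "trig_poly (\<lambda>w. c * plane_wave z w * g w)"
  using assms
proof induction
  case (wave d y)
  have "(\<lambda>w. c * plane_wave z w * (d * plane_wave y w)) = (\<lambda>w. (c * d) * plane_wave (z + y) w)"
    by (auto simp: plane_wave_mult[symmetric])
  then show ?case by (metis trig_poly.wave)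
next
  case (add f g)
  then show ?case using trig_poly.add by (simp add: distrib_left)
qed

lemma trig_poly_mult:
  assumes "trig_poly f" "trig_poly g"
  shows "trig_poly (\<lambda>w. f w * g w)"
  using assms(1)
proof induction
  case (wave d y)
  then show ?case using trig_poly_wave_mult[OF assms(2)] by simp
next
  case (add f g)
  then show ?case using trig_poly.add by (simp add: distrib_right)
qed

lemma trig_poly_const: "trig_poly (\<lambda>_. c)"
  using trig_poly.wave[of c 0] by simp

lemma trig_poly_sin: "trig_poly (\<lambda>w. of_real (sin (Re (cnj z * w))))"
proof -
  have "(\<lambda>w. of_real (sin (Re (cnj z * w))))
      = (\<lambda>w. (- \<i> / 2) * plane_wave z w + (\<i> / 2) * plane_wave (- z) w)"
  proof
    fix w
    define x where "x = Re (cnj z * w)"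
    have x: "Re (cnj (- z) * w) = - x" by (simp add: x_def)
    show "of_real (sin (Re (cnj z * w))) = (- \<i> / 2) * plane_wave z w + (\<i> / 2) * plane_wave (- z) w"
      unfolding plane_wave_def x x_def[symmetric] by (simp add: complex_eq_iff)
  qed
  then show ?thesis by (simp only: trig_poly.intros)
qed

text \<open>A bounded, coordinatewise periodic substitute for the identity, to which it converges
  locally uniformly as \<open>L \<rightarrow> \<infinity>\<close>.\<close>

definition sin_trunc :: "real \<Rightarrow> complex \<Rightarrow> complex" where
  "sin_trunc L w = Complex (L * sin (Re w / L)) (L * sin (Im w / L))"

text \<open>This is the reason for truncating by sines and not by a cutoff: linear functionals of
  the truncation are combinations of two sines, and sums and products stay in the algebra.\<close>

lemma trig_poly_sin_trunc:
  assumes "real_polynomial_function p"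
  shows "trig_poly (\<lambda>w. of_real (p (sin_trunc L w)))"
  using assms
proof induction
  case (linear f)
  interpret bounded_linear f by fact
  have f: "f u = Re u * f 1 + Im u * f \<i>" for u
  proof -
    have "u = Re u *\<^sub>R 1 + Im u *\<^sub>R \<i>" by (simp add: complex_eq_iff)
    then have "f u = f (Re u *\<^sub>R 1 + Im u *\<^sub>R \<i>)" by simp
    also have "\<dots> = Re u * f 1 + Im u * f \<i>" by (simp add: add scaleR)
    finally show ?thesis .
  qed
  \<comment> \<open>The frequencies \<open>1 / L\<close> and \<open>\<i> / L\<close> select
    \<open>Re w / L\<close> and \<open>Im w / L\<close>.\<close>
  have eq: "(\<lambda>w. complex_of_real (f (sin_trunc L w)))
     = (\<lambda>w. of_real (L * f 1) * of_real (sin (Re (cnj (1 / L) * w)))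
          + of_real (L * f \<i>) * of_real (sin (Re (cnj (\<i> / L) * w))))"
    by (subst f) (simp add: sin_trunc_def mult_ac)
  show ?case
    unfolding eq by (simp only: trig_poly.add trig_poly_mult trig_poly_const trig_poly_sin)
next
  case (const c)
  then show ?case by (rule trig_poly_const)
next
  case (add f g)
  then show ?case by (simp add: trig_poly.add)
next
  case (mult f g)
  then show ?case by (simp add: trig_poly_mult)
qed

lemma dist_sin_trunc_le:
  assumes "L > 0" "norm w \<le> R"
  shows "dist (sin_trunc L w) w \<le> R\<^sup>2 / L"
proof -
  have *: "\<bar>L * sin (x / L) - x\<bar> \<le> R\<^sup>2 / (2 * L)" if "\<bar>x\<bar> \<le> R" for x
  proof -
    \<comment> \<open>The quadratic remainder is enough: after multiplication by \<open>L\<close> it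
      is still of order 1/L.\<close>
    have "\<bar>sin (x / L) - x / L\<bar> \<le> (x / L)\<^sup>2 / 2"
      using Maclaurin_sin_bound[of "x / L" 2]
      by (simp add: numeral_2_eq_2 sin_coeff_def)
    then have "L * \<bar>sin (x / L) - x / L\<bar> \<le> L * ((x / L)\<^sup>2 / 2)"
      using assms by (intro mult_left_mono) auto
    also have "\<dots> = x\<^sup>2 / (2 * L)"
      using assms by (simp add: power2_eq_square field_simps)
    also have "\<dots> \<le> R\<^sup>2 / (2 * L)"
      using that assms power_mono[of "\<bar>x\<bar>" R 2] by (intro divide_right_mono) auto
    also have "L * \<bar>sin (x / L) - x / L\<bar> = \<bar>L * sin (x / L) - x\<bar>"
      using assms abs_mult[of L "sin (x / L) - x / L"] by (simp add: algebra_simps)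
    finally show ?thesis .
  qed
  have "dist (sin_trunc L w) w \<le> \<bar>L * sin (Re w / L) - Re w\<bar> + \<bar>L * sin (Im w / L) - Im w\<bar>"
    using cmod_le[of "sin_trunc L w - w"] by (simp add: dist_norm sin_trunc_def)
  also have "\<dots> \<le> R\<^sup>2 / (2 * L) + R\<^sup>2 / (2 * L)"
    using assms abs_Re_le_cmod[of w] abs_Im_le_cmod[of w] by (intro add_mono *) auto
  finally show ?thesis by (simp add: field_simps)
qed

lemma sin_trunc_tendsto: "(\<lambda>i. sin_trunc (real i) w) \<longlonglongrightarrow> w"
proof (rule iffD2[OF tendsto_dist_iff], rule tendsto_sandwich[OF _ _ tendsto_const])
  show "eventually (\<lambda>i. dist (sin_trunc (real i) w) w \<le> (norm w)\<^sup>2 / real i) sequentially"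
    using eventually_gt_at_top[of 0] by eventually_elim (auto intro!: dist_sin_trunc_le)
  show "(\<lambda>i. (norm w)\<^sup>2 / real i) \<longlonglongrightarrow> 0" by (rule lim_const_over_n)
qed auto

lemma continuous_sin_trunc: "continuous_on UNIV (sin_trunc L)"
  unfolding sin_trunc_def by (cases "L = 0") (auto intro!: continuous_intros)

lemma norm_sin_trunc_le: "norm (sin_trunc L w) \<le> 2 * \<bar>L\<bar>"
proof -
  have *: "\<bar>L * sin x\<bar> \<le> \<bar>L\<bar>" for x
    by (simp add: abs_mult mult_left_le)
  show ?thesis
    using cmod_le[of "sin_trunc L w"] *[of "Re w / L"] *[of "Im w / L"] by (simp add: sin_trunc_def)
qed

section \<open>From plane waves to continuous test functions\<close>

lemma borel_measurable_trig_poly: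
  "trig_poly f \<Longrightarrow> f \<in> borel_measurable borel"
  by (induction rule: trig_poly.induct) measurable

lemma bounded_trig_poly:
  "trig_poly f \<Longrightarrow> \<exists>B. \<forall>w. norm (f w) \<le> B"
proof (induction rule: trig_poly.induct)
  case (wave c z)
  then show ?case by (intro exI[of _ "norm c"]) (simp add: norm_mult)
next
  case (add f g)
  then show ?case by (meson norm_triangle_mono)
qed

lemma integrable_trig_poly:
  assumes "trig_poly f" "prob_space M" "X \<in> borel_measurable M"
  shows "integrable M (\<lambda>w. f (X w))"
proof -
  interpret prob_space M by fact
  obtain B where "\<And>w. norm (f w) \<le> B" using bounded_trig_poly[OF assms(1)] by blast
  then show ?thesis
    using borel_measurable_trig_poly[OF assms(1)] assms(3)
    by (intro integrable_const_bound[where B=B]) auto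
qed

lemma trig_poly_integral_tendsto:
  assumes "trig_poly f"
    and "\<forall>\<^sub>F n in sequentially. prob_space (M n) \<and> X n \<in> borel_measurable (M n)"
    and "prob_space N" "Y \<in> borel_measurable N"
    and wave: "\<And>z. (\<lambda>n. \<integral>w. plane_wave z (X n w) \<partial>M n) \<longlonglongrightarrow> (\<integral>w. plane_wave z (Y w) \<partial>N)"
  shows "(\<lambda>n. \<integral>w. f (X n w) \<partial>M n) \<longlonglongrightarrow> (\<integral>w. f (Y w) \<partial>N)"
  using assms(1)
proof induction
  case (wave c z)
  then show ?case by (simp add: tendsto_mult_left assms(5))
next
  case (add f g)
  have "\<forall>\<^sub>F n in sequentially. (\<integral>w. f (X n w) \<partial>M n) + (\<integral>w. g (X n w) \<partial>M n) = (\<integral>w. f (X n w) + g (X n w) \<partial>M n)"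
    using assms(2)
    by eventually_elim (simp add: integrable_trig_poly add.hyps)
  with tendsto_add[OF add.IH] have
    "(\<lambda>n. \<integral>w. f (X n w) + g (X n w) \<partial>M n) \<longlonglongrightarrow> (\<integral>w. f (Y w) \<partial>N) + (\<integral>w. g (Y w) \<partial>N)"
    by (rule Lim_transform_eventually)
  then show ?case by (simp add: integrable_trig_poly add.hyps assms(3,4))
qed

text \<open>Inside the ball of radius \<open>R\<close>, uniform continuity gives
  \<open>\<epsilon>\<close>. Outside, the trivial bound \<open>2 * B\<close> is multiplied by
  \<open>(norm w)\<^sup>2 / R\<^sup>2\<close>, which is at least 1; this is Chebyshev's inequality
  before integration.\<close>

lemma sin_trunc_test_function_approx:
  fixes f :: "complex \<Rightarrow> real"
  assumes f: "continuous_on UNIV f" "\<And>w. \<bar>f w\<bar> \<le> B" and "\<epsilon> > 0" "R > 0"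
  shows "\<forall>\<^sub>F i in sequentially. \<forall>w. \<bar>f w - f (sin_trunc (real i) w)\<bar> \<le> \<epsilon> + 2 * B / R\<^sup>2 * (norm w)\<^sup>2"
proof -
  \<comment> \<open>The radius is enlarged by 1 because the truncation moves a point of the smaller
    ball by less than \<open>min d 1\<close>.\<close>
  have "uniformly_continuous_on (cball 0 (R + 1)) f"
    using f(1) by (intro compact_uniformly_continuous continuous_on_subset[OF f(1)]) auto
  then obtain d where d: "d > 0"
    "\<And>u w. u \<in> cball 0 (R + 1) \<Longrightarrow> w \<in> cball 0 (R + 1) \<Longrightarrow> dist u w < d \<Longrightarrow> dist (f u) (f w) < \<epsilon>"
    using \<open>\<epsilon> > 0\<close> unfolding uniformly_continuous_on_def by metis
  have "B \<ge> 0" using f(2)[of 0] by linarith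
  have "(\<lambda>i. R\<^sup>2 / real i) \<longlonglongrightarrow> 0" by (rule lim_const_over_n)
  then have "\<forall>\<^sub>F i in sequentially. R\<^sup>2 / real i < min d 1"
    using d(1) by (intro order_tendstoD(2)) auto
  then show ?thesis
    using eventually_gt_at_top[of 0]
  proof eventually_elim
    case (elim i)
    show ?case
    proof
      fix w
      show "\<bar>f w - f (sin_trunc (real i) w)\<bar> \<le> \<epsilon> + 2 * B / R\<^sup>2 * (norm w)\<^sup>2"
      proof (cases "norm w \<le> R")
        case True
        then have less: "dist (sin_trunc (real i) w) w < min d 1"
          using dist_sin_trunc_le[of "real i" w R] elim by linarith
        have "norm (sin_trunc (real i) w) \<le> norm w + dist (sin_trunc (real i) w) w"
          unfolding dist_norm by (rule norm_triangle_sub)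
        then have "dist (f (sin_trunc (real i) w)) (f w) < \<epsilon>"
          using True less by (intro d(2)) auto
        then show ?thesis
          using \<open>B \<ge> 0\<close> by (intro add_increasing2) (auto simp: dist_real_def abs_minus_commute)
      next
        case False
        then have "1 \<le> (norm w)\<^sup>2 / R\<^sup>2" using \<open>R > 0\<close> by (simp add: power_mono)
        then have "2 * B \<le> 2 * B / R\<^sup>2 * (norm w)\<^sup>2"
          using \<open>B \<ge> 0\<close> mult_left_mono[of 1 "(norm w)\<^sup>2 / R\<^sup>2" "2 * B"] by simp
        then show ?thesis
          using f(2)[of w] f(2)[of "sin_trunc (real i) w"] \<open>\<epsilon> > 0\<close> by linarith
      qed
    qed
  qed
qed

text \<open>Composed with the truncation, a continuous test function is uniformly close on the whole
  plane to a trigonometric polynomial; the second moments control the truncation error.\<close>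

lemma converges_in_distribution_plane_wave:
  assumes M: "\<forall>\<^sub>F n in sequentially. prob_space (M n) \<and> X n \<in> borel_measurable (M n) \<and>
      integrable (M n) (\<lambda>w. (norm (X n w))\<^sup>2) \<and> (\<integral>w. (norm (X n w))\<^sup>2 \<partial>M n) \<le> C"
    and N: "prob_space N" "Y \<in> borel_measurable N"
    and wave: "\<And>z. (\<lambda>n. \<integral>w. plane_wave z (X n w) \<partial>M n) \<longlonglongrightarrow> (\<integral>w. plane_wave z (Y w) \<partial>N)"
  shows "converges_in_distribution M X N Y"
  unfolding converges_in_distribution_def
proof (intro allI impI)
  fix f :: "complex \<Rightarrow> real"
  assume "continuous_on UNIV f \<and> bounded (range f)"
  then obtain B where f: "continuous_on UNIV f" "\<And>w. \<bar>f w\<bar> \<le> B"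
    by (auto simp: bounded_iff)
  interpret N: prob_space N by fact
  note [measurable] = N(2) borel_measurable_continuous_onI[OF f(1)]
    borel_measurable_continuous_onI[OF continuous_sin_trunc]
  have "B \<ge> 0" using f(2)[of 0] by linarith
  show "(\<lambda>n. \<integral>w. f (X n w) \<partial>M n) \<longlonglongrightarrow> (\<integral>w. f (Y w) \<partial>N)"
  proof (rule tendstoI)
    fix e :: real assume "e > 0"
    \<comment> \<open>The errors collected below are 3, 1, 1 and 1 times \<open>\<epsilon>\<close>,
      in total less than \<open>e\<close>.\<close>
    define \<epsilon> where "\<epsilon> = e / 8"
    have "\<epsilon> > 0" using \<open>e > 0\<close> by (simp add: \<epsilon>_def)
    \<comment> \<open>Chosen so that the Chebyshev term
      \<open>2 * B / R\<^sup>2 * \<bar>C\<bar>\<close> is at most \<open>\<epsilon>\<close>; the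
      summand 1 keeps \<open>R\<close> positive.\<close>
    define R where "R = sqrt (2 * B * \<bar>C\<bar> / \<epsilon>) + 1"
    have "R > 0" unfolding R_def using \<open>\<epsilon> > 0\<close> \<open>B \<ge> 0\<close> by (intro add_nonneg_pos) auto
    have "2 * B * \<bar>C\<bar> / \<epsilon> \<le> R\<^sup>2"
    proof -
      have "2 * B * \<bar>C\<bar> / \<epsilon> = (sqrt (2 * B * \<bar>C\<bar> / \<epsilon>))\<^sup>2"
        using \<open>\<epsilon> > 0\<close> \<open>B \<ge> 0\<close> by simp
      also have "\<dots> \<le> R\<^sup>2"
        unfolding R_def using \<open>\<epsilon> > 0\<close> \<open>B \<ge> 0\<close> by (intro power_mono) auto
      finally show ?thesis .
    qed
    then have BC: "2 * B / R\<^sup>2 * \<bar>C\<bar> \<le> \<epsilon>"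
      using \<open>\<epsilon> > 0\<close> \<open>R > 0\<close> by (simp add: field_simps)
    \<comment> \<open>For the limit variable the truncation is removed by dominated convergence; the
      moment bound serves the \<open>X n\<close>, where uniformity in \<open>n\<close>
      matters.\<close>
    have "(\<lambda>i. \<integral>w. f (sin_trunc (real i) (Y w)) \<partial>N) \<longlonglongrightarrow> (\<integral>w. f (Y w) \<partial>N)"
    proof (rule integral_dominated_convergence[where w="\<lambda>_. B"])
      show "AE w in N. (\<lambda>i. f (sin_trunc (real i) (Y w))) \<longlonglongrightarrow> f (Y w)"
        using continuous_on_tendsto_compose[OF f(1) sin_trunc_tendsto] by auto
    qed (use f(2) in auto)
    then have "\<forall>\<^sub>F i in sequentially. dist (\<integral>w. f (sin_trunc (real i) (Y w)) \<partial>N) (\<integral>w. f (Y w) \<partial>N) < \<epsilon>"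
      using \<open>\<epsilon> > 0\<close> by (rule tendstoD)
    with sin_trunc_test_function_approx[OF f \<open>\<epsilon> > 0\<close> \<open>R > 0\<close>]
    have "\<exists>i. (\<forall>w. \<bar>f w - f (sin_trunc (real i) w)\<bar> \<le> \<epsilon> + 2 * B / R\<^sup>2 * (norm w)\<^sup>2) \<and>
       dist (\<integral>w. f (sin_trunc (real i) (Y w)) \<partial>N) (\<integral>w. f (Y w) \<partial>N) < \<epsilon>"
      by (intro eventually_happens'[OF sequentially_bot] eventually_conj)
    then obtain L where L: "\<And>w. \<bar>f w - f (sin_trunc L w)\<bar> \<le> \<epsilon> + 2 * B / R\<^sup>2 * (norm w)\<^sup>2"
      "\<bar>(\<integral>w. f (sin_trunc L (Y w)) \<partial>N) - (\<integral>w. f (Y w) \<partial>N)\<bar> < \<epsilon>"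
      unfolding dist_real_def by blast
    obtain p where p: "real_polynomial_function p"
      "\<And>w. w \<in> cball 0 (2 * \<bar>L\<bar>) \<Longrightarrow> \<bar>f w - p w\<bar> < \<epsilon>"
      using Stone_Weierstrass_real_polynomial_function[of "cball 0 (2 * \<bar>L\<bar>)" f \<epsilon>]
        continuous_on_subset[OF f(1)] \<open>\<epsilon> > 0\<close> by auto
    define q where "q = (\<lambda>w. p (sin_trunc L w))"
    have trig: "trig_poly (\<lambda>w. of_real (q w))"
      unfolding q_def by (rule trig_poly_sin_trunc[OF p(1)])
    have q: "\<bar>f (sin_trunc L w) - q w\<bar> \<le> \<epsilon>" for w
      unfolding q_def using norm_sin_trunc_le[of L w] by (intro less_imp_le[OF p(2)]) auto
    have int_q: "integrable P (\<lambda>w. q (Z w))" if "prob_space P" "Z \<in> borel_measurable P" for P :: "'c measure" and Z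
      using integrable_trig_poly[OF trig that] by (simp add: complex_of_real_integrable_eq)
    have int_q': "integrable P (\<lambda>w. q (Z w))" if "prob_space P" "Z \<in> borel_measurable P" for P :: "'d measure" and Z
      using integrable_trig_poly[OF trig that] by (simp add: complex_of_real_integrable_eq)
    have "(\<lambda>n. \<integral>w. complex_of_real (q (X n w)) \<partial>M n) \<longlonglongrightarrow> (\<integral>w. complex_of_real (q (Y w)) \<partial>N)"
      using trig_poly_integral_tendsto[OF trig eventually_mono[OF M] N wave] by blast
    then have "(\<lambda>n. \<integral>w. q (X n w) \<partial>M n) \<longlonglongrightarrow> (\<integral>w. q (Y w) \<partial>N)"
      by (simp add: tendsto_of_real_iff)
    then have "\<forall>\<^sub>F n in sequentially. dist (\<integral>w. q (X n w) \<partial>M n) (\<integral>w. q (Y w) \<partial>N) < \<epsilon>"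
      using \<open>\<epsilon> > 0\<close> by (rule tendstoD)
    then show "\<forall>\<^sub>F n in sequentially. dist (\<integral>w. f (X n w) \<partial>M n) (\<integral>w. f (Y w) \<partial>N) < e"
      using M
    proof eventually_elim
      case (elim n)
      interpret M: prob_space "M n" using elim by blast
      have [measurable]: "X n \<in> borel_measurable (M n)" using elim by blast
      have int_sq: "integrable (M n) (\<lambda>w. (norm (X n w))\<^sup>2)" using elim by blast
      have int_f: "integrable (M n) (\<lambda>w. f (X n w))"
        using f(2) by (intro M.integrable_const_bound[where B=B]) auto
      have int_fs: "integrable N (\<lambda>w. f (sin_trunc L (Y w)))"
        using f(2) by (intro N.integrable_const_bound[where B=B]) auto
      have "\<bar>(\<integral>w. f (X n w) \<partial>M n) - (\<integral>w. q (X n w) \<partial>M n)\<bar>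
          = \<bar>\<integral>w. f (X n w) - q (X n w) \<partial>M n\<bar>"
        using int_f int_q[of "M n" "X n"] elim by simp
      also have "\<dots> \<le> (\<integral>w. 2 * \<epsilon> + 2 * B / R\<^sup>2 * (norm (X n w))\<^sup>2 \<partial>M n)"
      proof (rule norm_integral_le[where 'b=real, unfolded real_norm_def])
        fix w
        show "\<bar>f (X n w) - q (X n w)\<bar> \<le> 2 * \<epsilon> + 2 * B / R\<^sup>2 * (norm (X n w))\<^sup>2"
          using L(1)[of "X n w"] q[of "X n w"] by linarith
      qed (use int_f int_q[of "M n" "X n"] elim int_sq in auto)
      also have "\<dots> = 2 * \<epsilon> + 2 * B / R\<^sup>2 * (\<integral>w. (norm (X n w))\<^sup>2 \<partial>M n)"
        using int_sq by (simp add: M.prob_space)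
      also have "\<dots> \<le> 2 * \<epsilon> + 2 * B / R\<^sup>2 * \<bar>C\<bar>"
        using elim \<open>B \<ge> 0\<close> by (intro add_left_mono mult_left_mono) auto
      finally have 1: "\<bar>(\<integral>w. f (X n w) \<partial>M n) - (\<integral>w. q (X n w) \<partial>M n)\<bar> \<le> 3 * \<epsilon>"
        using BC by simp
      have "\<bar>(\<integral>w. f (sin_trunc L (Y w)) \<partial>N) - (\<integral>w. q (Y w) \<partial>N)\<bar>
          = \<bar>\<integral>w. f (sin_trunc L (Y w)) - q (Y w) \<partial>N\<bar>"
        using int_fs int_q'[OF N] by simp
      also have "\<dots> \<le> (\<integral>w. \<epsilon> \<partial>N)"
        using int_fs int_q'[OF N] q by (intro norm_integral_le[where 'b=real, unfolded real_norm_def]) auto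
      finally have 2: "\<bar>(\<integral>w. f (sin_trunc L (Y w)) \<partial>N) - (\<integral>w. q (Y w) \<partial>N)\<bar> \<le> \<epsilon>"
        by (simp add: N.prob_space)
      have "dist (\<integral>w. f (X n w) \<partial>M n) (\<integral>w. f (Y w) \<partial>N) \<le> 6 * \<epsilon>"
        using 1 2 L(2) elim(1) unfolding dist_real_def by linarith
      then show ?case using \<open>\<epsilon> > 0\<close> unfolding \<epsilon>_def by linarith
    qed
  qed
qed

section \<open>Unitary matrices and the Haar measure\<close>

lemma dim_mat_adjoint [simp]:
  "dim_row (mat_adjoint A) = dim_col A" "dim_col (mat_adjoint A) = dim_row A"
  by (simp_all add: mat_adjoint_def)

lemma mat_adjoint_index [simp]:
  fixes A :: "complex mat"
  assumes "i < dim_col A" "j < dim_row A"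
  shows "mat_adjoint A $$ (i, j) = cnj (A $$ (j, i))"
  using assms by (simp add: mat_adjoint_def mat_of_rows_def)

lemma mat_adjoint_carrier [simp]: "A \<in> carrier_mat n m \<Longrightarrow> mat_adjoint A \<in> carrier_mat m n"
  by auto

lemma mat_adjoint_adjoint [simp]: "mat_adjoint (mat_adjoint A) = (A :: complex mat)"
  by (rule eq_matI) auto

lemma mat_mult_index_sum:
  assumes "A \<in> carrier_mat n n" "B \<in> carrier_mat n n" "i < n" "j < n"
  shows "(A * B) $$ (i, j) = (\<Sum>k<n. A $$ (i, k) * B $$ (k, j))"
  using assms by (auto simp: scalar_prod_def lessThan_atLeast0 intro!: sum.cong)

lemma mat_adjoint_mult:
  fixes A B :: "complex mat"
  assumes "A \<in> carrier_mat n n" "B \<in> carrier_mat n n"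
  shows "mat_adjoint (A * B) = mat_adjoint B * mat_adjoint A"
proof (rule eq_matI)
  fix i j assume "i < dim_row (mat_adjoint B * mat_adjoint A)" "j < dim_col (mat_adjoint B * mat_adjoint A)"
  then have ij: "i < n" "j < n" using assms by auto
  show "mat_adjoint (A * B) $$ (i, j) = (mat_adjoint B * mat_adjoint A) $$ (i, j)"
    using assms ij
    by (simp add: mat_mult_index_sum[where n=n] mult.commute del: index_mult_mat(1))
qed (use assms in auto)

lemma unitary_group_carrier: "A \<in> unitary_group n \<Longrightarrow> A \<in> carrier_mat n n"
  by (simp add: unitary_group_def)

lemma unitary_groupI:
  assumes "A \<in> carrier_mat n n" "A * mat_adjoint A = 1\<^sub>m n"
  shows "A \<in> unitary_group n"
  using assms mat_mult_left_right_inverse[OF assms(1) _ assms(2)] by (simp add: unitary_group_def)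

lemma unitary_group_adjoint: "A \<in> unitary_group n \<Longrightarrow> mat_adjoint A \<in> unitary_group n"
  by (auto simp: unitary_group_def)

lemma unitary_group_mult:
  assumes "A \<in> unitary_group n" "B \<in> unitary_group n"
  shows "A * B \<in> unitary_group n"
proof (rule unitary_groupI)
  have A: "A \<in> carrier_mat n n" "A * mat_adjoint A = 1\<^sub>m n"
    and B: "B \<in> carrier_mat n n" "B * mat_adjoint B = 1\<^sub>m n"
    using assms by (auto simp: unitary_group_def)
  show "A * B \<in> carrier_mat n n" using A B by auto
  have "A * B * mat_adjoint (A * B) = A * B * (mat_adjoint B * mat_adjoint A)"
    using A B by (simp add: mat_adjoint_mult)
  also have "\<dots> = A * (B * (mat_adjoint B * mat_adjoint A))"
    by (rule assoc_mult_mat) (use A B in auto)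
  also have "B * (mat_adjoint B * mat_adjoint A) = B * mat_adjoint B * mat_adjoint A"
    by (rule assoc_mult_mat[symmetric]) (use A B in auto)
  also have "A * \<dots> = 1\<^sub>m n" using A B by simp
  finally show "A * B * mat_adjoint (A * B) = 1\<^sub>m n" .
qed

lemma unitary_group_cancel:
  assumes "V \<in> unitary_group n" "A \<in> unitary_group n"
  shows "mat_adjoint V * (V * A) = A" "V * (mat_adjoint V * A) = A"
proof -
  have V: "V \<in> carrier_mat n n" "V * mat_adjoint V = 1\<^sub>m n" "mat_adjoint V * V = 1\<^sub>m n"
    and A: "A \<in> carrier_mat n n"
    using assms by (auto simp: unitary_group_def)
  show "mat_adjoint V * (V * A) = A" "V * (mat_adjoint V * A) = A"
    using V A by (simp_all flip: assoc_mult_mat[where n\<^sub>1=n and n\<^sub>2=n and n\<^sub>3=n and n\<^sub>4=n])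
qed

lemma unitary_sum_row:
  assumes "A \<in> unitary_group n" "j < n"
  shows "(\<Sum>k<n. (norm (A $$ (j, k)))\<^sup>2) = 1"
proof -
  have A: "A \<in> carrier_mat n n" "A * mat_adjoint A = 1\<^sub>m n"
    using assms(1) by (auto simp: unitary_group_def)
  have "complex_of_real (\<Sum>k<n. (norm (A $$ (j, k)))\<^sup>2) = (\<Sum>k<n. A $$ (j, k) * mat_adjoint A $$ (k, j))"
    using A assms(2) by (auto simp: complex_norm_square simp del: of_real_power intro!: sum.cong)
  also have "\<dots> = (A * mat_adjoint A) $$ (j, j)"
    using A assms(2) by (intro mat_mult_index_sum[symmetric]) auto
  also have "\<dots> = complex_of_real 1" using A(2) assms(2) by simp
  finally show ?thesis by (simp only: of_real_eq_iff)
qed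

lemma unitary_sum_col:
  assumes "A \<in> unitary_group n" "k < n"
  shows "(\<Sum>j<n. (norm (A $$ (j, k)))\<^sup>2) = 1"
  using unitary_sum_row[OF unitary_group_adjoint[OF assms(1)] assms(2)]
    unitary_group_carrier[OF assms(1)] assms(2)
  by (simp add: carrier_matD)

lemma unitary_norm_entry_le:
  assumes "A \<in> unitary_group n" "j < n" "k < n"
  shows "norm (A $$ (j, k)) \<le> 1"
proof -
  have "(norm (A $$ (j, k)))\<^sup>2 \<le> (\<Sum>k<n. (norm (A $$ (j, k)))\<^sup>2)"
    using assms(3) by (intro member_le_sum) auto
  then show ?thesis using unitary_sum_row[OF assms(1,2)] by (simp add: power_le_one_iff)
qed

text \<open>The 2 x 2 block with rows \<open>(a, b)\<close> and \<open>(c, d)\<close> placed on the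
  coordinates \<open>j\<close>, \<open>k\<close>, and the identity elsewhere. Sign changes,
  transpositions and rotations of rows are all of this form.\<close>

definition row_mix :: "nat \<Rightarrow> nat \<Rightarrow> nat \<Rightarrow> complex \<Rightarrow> complex \<Rightarrow> complex \<Rightarrow> complex \<Rightarrow> complex mat" where
  "row_mix n j k a b c d = mat n n (\<lambda>(x, y).
     if x = j then a * of_bool (y = j) + b * of_bool (y = k)
     else if x = k then c * of_bool (y = j) + d * of_bool (y = k)
     else of_bool (x = y))"

lemma row_mix_mult_index:
  assumes "A \<in> carrier_mat n n" "j < n" "k < n" "x < n" "y < n"
  shows "(row_mix n j k a b c d * A) $$ (x, y) =
    (if x = j then a * A $$ (j, y) + b * A $$ (k, y)
     else if x = k then c * A $$ (j, y) + d * A $$ (k, y)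
     else A $$ (x, y))"
proof -
  have "(row_mix n j k a b c d * A) $$ (x, y)
      = (\<Sum>l<n. row_mix n j k a b c d $$ (x, l) * A $$ (l, y))"
    using assms by (intro mat_mult_index_sum) (auto simp: row_mix_def)
  also have "\<dots> = (\<Sum>l<n. if x = j then a * (of_bool (l = j) * A $$ (l, y)) + b * (of_bool (l = k) * A $$ (l, y))
     else if x = k then c * (of_bool (l = j) * A $$ (l, y)) + d * (of_bool (l = k) * A $$ (l, y))
     else of_bool (l = x) * A $$ (l, y))"
    using assms by (intro sum.cong) (auto simp: row_mix_def algebra_simps)
  also have "\<dots> = (if x = j then a * A $$ (j, y) + b * A $$ (k, y)
     else if x = k then c * A $$ (j, y) + d * A $$ (k, y)
     else A $$ (x, y))"
    using assms
    by (simp add: sum.distrib sum_distrib_left[symmetric] of_bool_def if_distrib[of "\<lambda>t. t * _"] cong: if_cong)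
  finally show ?thesis .
qed

text \<open>The equations state that the rows of the block are orthonormal.\<close>

lemma row_mix_unitary:
  assumes "j < n" "k < n" "j \<noteq> k"
    and "a * cnj a + b * cnj b = 1" "c * cnj c + d * cnj d = 1" "a * cnj c + b * cnj d = 0"
  shows "row_mix n j k a b c d \<in> unitary_group n"
proof (rule unitary_groupI)
  let ?V = "row_mix n j k a b c d"
  show V: "?V \<in> carrier_mat n n" by (simp add: row_mix_def)
  have ca: "c * cnj a + d * cnj b = 0"
    using arg_cong[OF assms(6), of cnj] by (simp add: mult.commute)
  show "?V * mat_adjoint ?V = 1\<^sub>m n"
  proof (rule eq_matI)
    fix x y assume "x < dim_row (1\<^sub>m n)" "y < dim_col (1\<^sub>m n)"
    then have xy: "x < n" "y < n" by auto
    have adj: "mat_adjoint ?V $$ (u, y) = cnj (?V $$ (y, u))" if "u < n" for u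
      using V xy that by simp
    show "(?V * mat_adjoint ?V) $$ (x, y) = 1\<^sub>m n $$ (x, y)"
      \<comment> \<open>The product with the adjoint is itself a row operation, applied to the
        adjoint, so the multiplication formula evaluates it.\<close>
      unfolding row_mix_mult_index[OF mat_adjoint_carrier[OF V] assms(1,2) xy]
      using xy assms ca adj[OF assms(1)] adj[OF assms(2)] adj[OF xy(1)]
      by (auto simp: row_mix_def)
  qed (auto simp: row_mix_def)
qed

section \<open>Borel structure of the unitary group and invariant integrals\<close>

lemma space_unitary_borel [simp]: "space (unitary_borel n) = unitary_group n"
  by (simp add: unitary_borel_def)

lemma measurable_unitary_entry:
  assumes "i < n" "j < n"
  shows "(\<lambda>A. A $$ (i, j)) \<in> borel_measurable (unitary_borel n)"
proof -
  have "mat_entries n \<in> measurable (unitary_borel n) borel"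
    unfolding unitary_borel_def by (rule measurable_vimage_algebra1) auto
  then have "(\<lambda>A. mat_entries n A (i, j)) \<in> borel_measurable (unitary_borel n)"
    by (rule measurable_product_then_coordinatewise)
  then show ?thesis using assms by (simp add: mat_entries_def)
qed

text \<open>The sigma-algebra is pulled back from a product space, so measurability is tested on
  entries; those outside the block are constantly 0.\<close>

lemma measurable_unitary_borelI:
  assumes "\<And>x. x \<in> space N \<Longrightarrow> g x \<in> unitary_group n"
    and "\<And>i j. i < n \<Longrightarrow> j < n \<Longrightarrow> (\<lambda>x. g x $$ (i, j)) \<in> borel_measurable N"
  shows "g \<in> measurable N (unitary_borel n)"
  unfolding unitary_borel_def
proof (rule measurable_vimage_algebra2)
  show "(\<lambda>x. mat_entries n (g x)) \<in> borel_measurable N"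
  proof (rule measurable_coordinatewise_then_product)
    fix p :: "nat \<times> nat"
    show "(\<lambda>x. mat_entries n (g x) p) \<in> borel_measurable N"
      using assms(2) by (cases p; cases "fst p < n \<and> snd p < n") (auto simp: mat_entries_def)
  qed
qed (use assms(1) in auto)

lemma measurable_unitary_mult:
  assumes "V \<in> unitary_group n"
  shows "(\<lambda>A. V * A) \<in> measurable (unitary_borel n) (unitary_borel n)"
proof (rule measurable_unitary_borelI)
  fix i j assume ij: "i < n" "j < n"
  have "(\<lambda>A. \<Sum>k<n. V $$ (i, k) * A $$ (k, j)) \<in> borel_measurable (unitary_borel n)"
    using ij by (intro borel_measurable_sum borel_measurable_times measurable_unitary_entry) auto
  then show "(\<lambda>A. (V * A) $$ (i, j)) \<in> borel_measurable (unitary_borel n)"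
    using ij assms
    by (subst measurable_cong[where g="\<lambda>A. \<Sum>k<n. V $$ (i, k) * A $$ (k, j)"])
      (auto intro!: mat_mult_index_sum simp: unitary_group_carrier simp del: index_mult_mat(1))
qed (use assms unitary_group_mult in auto)

text \<open>All expectations are computed on the group itself. The random matrices of the theorem
  enter at the very end, through their law.\<close>

locale haar_unitary = prob_space \<mu> for \<mu> :: "complex mat measure" +
  fixes n :: nat
  assumes haar: "normalized_haar_unitary n \<mu>"
begin

lemma sets_haar [measurable_cong, simp]: "sets \<mu> = sets (unitary_borel n)"
  using haar by (simp add: normalized_haar_unitary_def)

lemma space_haar [simp]: "space \<mu> = unitary_group n"
  using sets_eq_imp_space_eq[OF sets_haar] by simp

lemma measurable_entry [measurable]:
  "i < n \<Longrightarrow> j < n \<Longrightarrow> (\<lambda>A. A $$ (i, j)) \<in> borel_measurable \<mu>"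
  using measurable_unitary_entry[of i n j] by simp

lemma measurable_mult:
  assumes "V \<in> unitary_group n"
  shows "(\<lambda>A. V * A) \<in> measurable \<mu> \<mu>"
  using measurable_unitary_mult[OF assms] by (simp cong: measurable_cong_sets)

text \<open>Invariance is given for images of sets, whereas an image measure is about preimages. The
  preimage under \<open>V\<close> is the image under the inverse, which is the adjoint.\<close>

lemma distr_mult:
  assumes V: "V \<in> unitary_group n"
  shows "distr \<mu> \<mu> (\<lambda>A. V * A) = \<mu>"
proof (rule measure_eqI)
  fix S assume "S \<in> sets (distr \<mu> \<mu> (\<lambda>A. V * A))"
  then have S: "S \<in> sets \<mu>" by simp
  have "S \<subseteq> unitary_group n" using sets.sets_into_space[OF S] by simp
  have "(\<lambda>A. V * A) -` S \<inter> space \<mu> = (\<lambda>A. mat_adjoint V * A) ` S"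
  proof (intro equalityI subsetI)
    fix A assume "A \<in> (\<lambda>A. V * A) -` S \<inter> space \<mu>"
    then show "A \<in> (\<lambda>A. mat_adjoint V * A) ` S"
      using unitary_group_cancel(1)[OF V, of A] by (intro image_eqI[of _ _ "V * A"]) auto
  next
    fix A assume "A \<in> (\<lambda>A. mat_adjoint V * A) ` S"
    then show "A \<in> (\<lambda>A. V * A) -` S \<inter> space \<mu>"
      using unitary_group_cancel(2)[OF V] \<open>S \<subseteq> unitary_group n\<close>
        unitary_group_mult[OF unitary_group_adjoint[OF V]] by auto
  qed
  then show "emeasure (distr \<mu> \<mu> (\<lambda>A. V * A)) S = emeasure \<mu> S"
    using haar S unitary_group_adjoint[OF V] measurable_mult[OF V]
    by (simp add: emeasure_distr normalized_haar_unitary_def)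
qed simp

lemma integral_mult:
  fixes F :: "complex mat \<Rightarrow> 'b::{banach, second_countable_topology}"
  assumes V: "V \<in> unitary_group n" and F: "F \<in> borel_measurable \<mu>"
  shows "(\<integral>A. F (V * A) \<partial>\<mu>) = (\<integral>A. F A \<partial>\<mu>)"
  using integral_distr[OF measurable_mult[OF V] F] by (simp add: distr_mult[OF V])

end

section \<open>Second moments\<close>

lemma borel_measurable_cnj [measurable (raw)]:
  "f \<in> borel_measurable M \<Longrightarrow> (\<lambda>x. cnj (f x)) \<in> borel_measurable M"
  by (rule borel_measurable_continuous_on[OF continuous_on_cnj[OF continuous_on_id]])

lemma unitary_trace_eq:
  "A \<in> unitary_group n \<Longrightarrow> trace_mat A = (\<Sum>i<n. A $$ (i, i))"
  using unitary_group_carrier[of A n] by (simp add: trace_mat_def carrier_matD)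

lemma trace_row_mix_mult:
  assumes A: "A \<in> unitary_group n" and jk: "j < n" "k < n" "j \<noteq> k"
    and V: "row_mix n j k a b c d \<in> unitary_group n"
  shows "trace_mat (row_mix n j k a b c d * A) = trace_mat A
    + ((a - 1) * A $$ (j, j) + b * A $$ (k, j)) + (c * A $$ (j, k) + (d - 1) * A $$ (k, k))"
proof -
  have "trace_mat (row_mix n j k a b c d * A)
     = (\<Sum>i<n. A $$ (i, i) + of_bool (i = j) * ((a - 1) * A $$ (j, j) + b * A $$ (k, j))
        + of_bool (i = k) * (c * A $$ (j, k) + (d - 1) * A $$ (k, k)))"
    unfolding unitary_trace_eq[OF unitary_group_mult[OF V A]]
    using jk by (intro sum.cong)
      (auto simp: row_mix_mult_index[OF unitary_group_carrier[OF A]] algebra_simps)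
  also have "\<dots> = trace_mat A
    + ((a - 1) * A $$ (j, j) + b * A $$ (k, j)) + (c * A $$ (j, k) + (d - 1) * A $$ (k, k))"
    unfolding unitary_trace_eq[OF A] using jk
    by (simp add: sum.distrib of_bool_def if_distrib[of "\<lambda>t. t * _"] cong: if_cong)
  finally show ?thesis .
qed

text \<open>\<open>row_mix\<close> always names two rows; \<open>r'\<close> is the one that it
  leaves fixed. These matrices kill the expectation of every product that is odd in row
  \<open>r\<close>.\<close>

lemma ex_row_flip:
  assumes "r < n" "r' < n" "r \<noteq> r'"
  shows "\<exists>V\<in>unitary_group n. \<forall>A\<in>unitary_group n. \<forall>x<n. \<forall>y<n.
      (V * A) $$ (x, y) = (if x = r then - A $$ (x, y) else A $$ (x, y))"
proof (rule bexI)
  show "row_mix n r r' (-1) 0 0 1 \<in> unitary_group n"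
    using assms by (intro row_mix_unitary) auto
  show "\<forall>A\<in>unitary_group n. \<forall>x<n. \<forall>y<n. (row_mix n r r' (-1) 0 0 1 * A) $$ (x, y)
      = (if x = r then - A $$ (x, y) else A $$ (x, y))"
    using assms by (auto simp: row_mix_mult_index[OF unitary_group_carrier])
qed

section \<open>Off-diagonal pairs and orthogonality of products of entries\<close>

definition off_diag :: "nat \<Rightarrow> (nat \<times> nat) set" where
  "off_diag n = {(j, k). j < n \<and> k < n \<and> j \<noteq> k}"

lemma finite_off_diag [simp]: "finite (off_diag n)"
  by (rule finite_subset[of _ "{..<n} \<times> {..<n}"]) (auto simp: off_diag_def)

lemma card_off_diag_le: "card (off_diag n) \<le> n * n"
proof -
  have "card (off_diag n) \<le> card ({..<n} \<times> {..<n})"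
    by (intro card_mono) (auto simp: off_diag_def)
  then show ?thesis by simp
qed

lemma sum_off_diag:
  fixes f :: "nat \<Rightarrow> nat \<Rightarrow> 'a::ab_group_add"
  shows "(\<Sum>(j, k)\<in>off_diag n. f j k) = (\<Sum>k<n. \<Sum>j<n. f j k) - (\<Sum>k<n. f k k)"
proof -
  have "(\<Sum>k<n. \<Sum>j<n. f j k) = (\<Sum>(j, k)\<in>{..<n} \<times> {..<n}. f j k)"
    by (subst sum.swap) (simp add: sum.cartesian_product)
  also have "{..<n} \<times> {..<n} = off_diag n \<union> (\<lambda>k. (k, k)) ` {..<n}"
    by (auto simp: off_diag_def)
  also have "(\<Sum>(j, k)\<in>\<dots>. f j k) = (\<Sum>(j, k)\<in>off_diag n. f j k) + (\<Sum>k<n. f k k)"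
    by (subst sum.union_disjoint[OF finite_off_diag]) (auto simp: sum.reindex inj_on_def, auto simp: off_diag_def)
  finally show ?thesis by simp
qed

context haar_unitary
begin

lemma prob_unitary_group [simp]: "prob (unitary_group n) = 1"
  using prob_space by simp

lemma measurable_trace [measurable]: "trace_mat \<in> borel_measurable \<mu>"
proof -
  have "(\<lambda>A. \<Sum>i<n. A $$ (i, i)) \<in> borel_measurable \<mu>"
    by (intro borel_measurable_sum measurable_entry) auto
  then show ?thesis
    by (subst measurable_cong[where g="\<lambda>A. \<Sum>i<n. A $$ (i, i)"]) (auto simp: unitary_trace_eq)
qed

lemma integrable_bounded:
  fixes F :: "complex mat \<Rightarrow> 'b::{banach, second_countable_topology}"
  assumes "F \<in> borel_measurable \<mu>" "\<And>A. A \<in> unitary_group n \<Longrightarrow> norm (F A) \<le> B"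
  shows "integrable \<mu> F"
  using assms by (intro integrable_const_bound[where B=B] AE_I2) auto

lemma integral_eq_0_of_mult_uminus:
  fixes F :: "complex mat \<Rightarrow> complex"
  assumes "V \<in> unitary_group n" "F \<in> borel_measurable \<mu>"
    and "\<And>A. A \<in> unitary_group n \<Longrightarrow> F (V * A) = - F A"
  shows "(\<integral>A. F A \<partial>\<mu>) = 0"
proof -
  have "(\<integral>A. F A \<partial>\<mu>) = (\<integral>A. F (V * A) \<partial>\<mu>)"
    using integral_mult[OF assms(1,2)] by simp
  also have "\<dots> = (\<integral>A. - F A \<partial>\<mu>)"
    using assms(3) by (intro Bochner_Integration.integral_cong) auto
  finally show ?thesis by simp
qed

text \<open>Transposing two rows shows that all entries of column \<open>k\<close> have the same
  second moment, and the squares in a column of a unitary matrix add up to 1.\<close>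

lemma integral_norm_entry_sq:
  assumes "j < n" "k < n"
  shows "(\<integral>A. (norm (A $$ (j, k)))\<^sup>2 \<partial>\<mu>) = 1 / n"
proof -
  have eq: "(\<integral>A. (norm (A $$ (i, k)))\<^sup>2 \<partial>\<mu>) = (\<integral>A. (norm (A $$ (j, k)))\<^sup>2 \<partial>\<mu>)" if "i < n" for i
  proof (cases "i = j")
    case False
    let ?V = "row_mix n i j 0 1 1 0"
    have "?V \<in> unitary_group n" using False assms that by (intro row_mix_unitary) auto
    moreover have "(\<lambda>A. (norm (A $$ (i, k)))\<^sup>2) \<in> borel_measurable \<mu>"
      using that assms by (intro borel_measurable_power borel_measurable_norm measurable_entry) auto
    ultimately have "(\<integral>A. (norm ((?V * A) $$ (i, k)))\<^sup>2 \<partial>\<mu>) = (\<integral>A. (norm (A $$ (i, k)))\<^sup>2 \<partial>\<mu>)"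
      by (rule integral_mult)
    moreover have "(\<integral>A. (norm ((?V * A) $$ (i, k)))\<^sup>2 \<partial>\<mu>) = (\<integral>A. (norm (A $$ (j, k)))\<^sup>2 \<partial>\<mu>)"
      using that assms
      by (intro Bochner_Integration.integral_cong)
        (auto simp: row_mix_mult_index[OF unitary_group_carrier])
    ultimately show ?thesis by simp
  qed simp
  have int: "integrable \<mu> (\<lambda>A. (norm (A $$ (i, k)))\<^sup>2)" if "i < n" for i
    using that assms unitary_norm_entry_le[of _ n i k]
    by (intro integrable_bounded[where B=1] borel_measurable_power borel_measurable_norm measurable_entry)
       (auto simp: power_le_one)
  have "real n * (\<integral>A. (norm (A $$ (j, k)))\<^sup>2 \<partial>\<mu>) = (\<Sum>i<n. \<integral>A. (norm (A $$ (i, k)))\<^sup>2 \<partial>\<mu>)"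
    by (simp add: eq)
  also have "\<dots> = (\<integral>A. (\<Sum>i<n. (norm (A $$ (i, k)))\<^sup>2) \<partial>\<mu>)"
    using int by (intro Bochner_Integration.integral_sum[symmetric]) auto
  also have "\<dots> = (\<integral>A. 1 \<partial>\<mu>)"
    using unitary_sum_col assms by (intro Bochner_Integration.integral_cong) auto
  finally show ?thesis using assms by (simp add: field_simps)
qed

lemma integral_diag_product:
  assumes "i < n" "j < n" "i \<noteq> j"
  shows "(\<integral>A. A $$ (i, i) * cnj (A $$ (j, j)) \<partial>\<mu>) = 0"
proof -
  obtain V where V: "V \<in> unitary_group n"
    "\<And>A x y. A \<in> unitary_group n \<Longrightarrow> x < n \<Longrightarrow> y < n \<Longrightarrow>
      (V * A) $$ (x, y) = (if x = i then - A $$ (x, y) else A $$ (x, y))"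
    using ex_row_flip[OF assms] by blast
  have [measurable]: "(\<lambda>A. A $$ (i, i)) \<in> borel_measurable \<mu>" "(\<lambda>A. A $$ (j, j)) \<in> borel_measurable \<mu>"
    using assms by auto
  show ?thesis
    by (rule integral_eq_0_of_mult_uminus[OF V(1)]) (use assms V(2) in auto)
qed

lemma norm_trace_le: "A \<in> unitary_group n \<Longrightarrow> norm (trace_mat A) \<le> n"
  unfolding unitary_trace_eq using sum_norm_le[of "{..<n}" "\<lambda>i. A $$ (i, i)" "\<lambda>_. 1"]
  by (simp add: unitary_norm_entry_le)

lemma integrable_norm_trace_sq: "integrable \<mu> (\<lambda>A. (norm (trace_mat A))\<^sup>2)"
  by (rule integrable_bounded[where B="(real n)\<^sup>2"]) (auto intro!: power_mono norm_trace_le)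

text \<open>In the expanded square the mixed terms vanish by sign changes, and the \<open>n\<close>
  diagonal terms contribute \<open>1 / n\<close> each. This supplies the uniform moment bound for
  convergence in distribution.\<close>

lemma integral_norm_trace_sq:
  assumes "n \<ge> 1"
  shows "(\<integral>A. (norm (trace_mat A))\<^sup>2 \<partial>\<mu>) = 1"
proof -
  have int: "integrable \<mu> (\<lambda>A. A $$ (i, i) * cnj (A $$ (j, j)))" if "i < n" "j < n" for i j
    using that unitary_norm_entry_le[of _ n i i] unitary_norm_entry_le[of _ n j j]
    by (intro integrable_bounded[where B=1] borel_measurable_times measurable_entry borel_measurable_cnj)
      (auto simp: norm_mult mult_le_one)
  have "complex_of_real (\<integral>A. (norm (trace_mat A))\<^sup>2 \<partial>\<mu>)
      = (\<integral>A. complex_of_real ((norm (trace_mat A))\<^sup>2) \<partial>\<mu>)"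
    by (simp only: integral_complex_of_real)
  also have "\<dots> = (\<integral>A. (\<Sum>i<n. \<Sum>j<n. A $$ (i, i) * cnj (A $$ (j, j))) \<partial>\<mu>)"
    by (intro Bochner_Integration.integral_cong)
      (auto simp: unitary_trace_eq complex_norm_square sum_product simp del: of_real_power)
  also have "\<dots> = (\<Sum>i<n. \<Sum>j<n. \<integral>A. A $$ (i, i) * cnj (A $$ (j, j)) \<partial>\<mu>)"
    using int by (subst Bochner_Integration.integral_sum)
      (auto intro!: Bochner_Integration.integrable_sum sum.cong Bochner_Integration.integral_sum)
  also have "\<dots> = (\<Sum>i<n. \<Sum>j<n. if j = i then complex_of_real (1 / n) else 0)"
  proof (intro sum.cong refl)
    fix i j assume ij: "i \<in> {..<n}" "j \<in> {..<n}"
    have "(\<integral>A. A $$ (i, i) * cnj (A $$ (i, i)) \<partial>\<mu>) = (\<integral>A. complex_of_real ((norm (A $$ (i, i)))\<^sup>2) \<partial>\<mu>)"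
      by (simp add: complex_norm_square del: of_real_power)
    also have "\<dots> = complex_of_real (1 / n)"
      using integral_norm_entry_sq[of i i] ij by (simp only: integral_complex_of_real lessThan_iff)
    finally show "(\<integral>A. A $$ (i, i) * cnj (A $$ (j, j)) \<partial>\<mu>) = (if j = i then complex_of_real (1 / n) else 0)"
      using integral_diag_product[of i j] ij by auto
  qed
  also have "\<dots> = 1" using assms by simp
  finally show ?thesis by (simp only: of_real_eq_1_iff)
qed

text \<open>Reversing the sign of row \<open>r\<close>, where \<open>r\<close> lies in \<open>{j, k}\<close> but not in \<open>{l, m}\<close>, shows that
  only \<open>{j, k} = {l, m}\<close> contributes.\<close>

lemma integral_entry_product_orthogonal:
  assumes "(j, k) \<in> off_diag n" "(l, m) \<in> off_diag n" "(l, m) \<noteq> (j, k)" "(l, m) \<noteq> (k, j)"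
  shows "(\<integral>A. (A $$ (j, k) * A $$ (k, j)) * cnj (A $$ (l, m) * A $$ (m, l)) \<partial>\<mu>) = 0"
proof -
  have n: "j < n" "k < n" "l < n" "m < n" "j \<noteq> k" "l \<noteq> m"
    using assms by (auto simp: off_diag_def)
  obtain r r' where r: "r \<in> {j, k}" "r \<notin> {l, m}" "r' \<in> {j, k}" "r \<noteq> r'"
    using assms n by auto
  then have "r < n" "r' < n" using n by auto
  then obtain V where V: "V \<in> unitary_group n"
    "\<And>A x y. A \<in> unitary_group n \<Longrightarrow> x < n \<Longrightarrow> y < n \<Longrightarrow>
      (V * A) $$ (x, y) = (if x = r then - A $$ (x, y) else A $$ (x, y))"
    using ex_row_flip[of r n r'] r(4) by blast
  \<comment> \<open>Exactly one of the four factors lies in row \<open>r\<close>, so the flip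
    reverses the sign of the product.\<close>
  show ?thesis
  proof (rule integral_eq_0_of_mult_uminus[OF V(1)])
    show "(\<lambda>A. (A $$ (j, k) * A $$ (k, j)) * cnj (A $$ (l, m) * A $$ (m, l))) \<in> borel_measurable \<mu>"
      using n by (intro borel_measurable_times borel_measurable_cnj measurable_entry) auto
  qed (use V(2) n r in auto)
qed

text \<open>This is the trace of the square of \<open>A\<close> without the squares of the diagonal
  entries.\<close>

definition off_diag_sq :: "complex mat \<Rightarrow> complex" where
  "off_diag_sq A = (\<Sum>(j, k)\<in>off_diag n. A $$ (j, k) * A $$ (k, j))"

lemma measurable_off_diag_sq [measurable]: "off_diag_sq \<in> borel_measurable \<mu>"
proof -
  have "(\<lambda>A. \<Sum>p\<in>off_diag n. A $$ (fst p, snd p) * A $$ (snd p, fst p)) \<in> borel_measurable \<mu>"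
    by (intro borel_measurable_sum borel_measurable_times measurable_entry) (auto simp: off_diag_def)
  then show ?thesis by (simp add: off_diag_sq_def[abs_def] case_prod_unfold)
qed

lemma norm_off_diag_sq_le:
  assumes "A \<in> unitary_group n"
  shows "norm (off_diag_sq A) \<le> card (off_diag n)"
proof -
  have "norm (off_diag_sq A) \<le> (\<Sum>p\<in>off_diag n. 1)"
    unfolding off_diag_sq_def using assms
    by (intro sum_norm_le) (auto simp: off_diag_def norm_mult intro!: mult_le_one unitary_norm_entry_le)
  then show ?thesis by simp
qed

text \<open>At most \<open>n * n\<close> pairs occur, each correlated only with itself and with its
  transpose, and each correlation is at most \<open>1 / n\<close>.\<close>

lemma integral_norm_off_diag_sq:
  assumes "n \<ge> 1"
  shows "(\<integral>A. (norm (off_diag_sq A))\<^sup>2 \<partial>\<mu>) \<le> 2 * n"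
proof -
  define g :: "nat \<times> nat \<Rightarrow> complex mat \<Rightarrow> complex"
    where "g p A = A $$ (fst p, snd p) * A $$ (snd p, fst p)" for p A
  have meas: "g p \<in> borel_measurable \<mu>" if "p \<in> off_diag n" for p
    using that unfolding g_def[abs_def]
    by (intro borel_measurable_times measurable_entry) (auto simp: off_diag_def)
  have g_le: "norm (g p A) \<le> norm (A $$ (fst p, snd p))" "norm (g p A) \<le> 1"
    if "p \<in> off_diag n" "A \<in> unitary_group n" for p A
    using that unfolding g_def norm_mult
    by (auto simp: off_diag_def intro!: mult_right_le_one_le mult_le_one unitary_norm_entry_le)
  have int: "integrable \<mu> (\<lambda>A. g p A * cnj (g q A))" if "p \<in> off_diag n" "q \<in> off_diag n" for p q
    using that g_le(2)[of p] g_le(2)[of q]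
    by (intro integrable_bounded[where B=1] borel_measurable_times borel_measurable_cnj meas)
      (auto simp: norm_mult intro!: mult_le_one)
  \<comment> \<open>One factor of each product is estimated by 1; the second moment of the other
    entry then gives \<open>1 / n\<close>.\<close>
  have bound: "norm (\<integral>A. g p A * cnj (g q A) \<partial>\<mu>) \<le> (if q \<in> {p, prod.swap p} then 1 / n else 0)"
    if pq: "p \<in> off_diag n" "q \<in> off_diag n" for p q
  proof (cases "q \<in> {p, prod.swap p}")
    case True
    have swap: "g (prod.swap p) = g p" by (auto simp: g_def)
    have "norm (\<integral>A. g p A * cnj (g q A) \<partial>\<mu>) \<le> (\<integral>A. (norm (A $$ (fst p, snd p)))\<^sup>2 \<partial>\<mu>)"
    proof (rule norm_integral_le[OF int[OF pq]])
      show "integrable \<mu> (\<lambda>A. (norm (A $$ (fst p, snd p)))\<^sup>2)"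
        using pq unitary_norm_entry_le[of _ n "fst p" "snd p"]
        by (intro integrable_bounded[where B=1] borel_measurable_power borel_measurable_norm measurable_entry)
          (auto simp: off_diag_def power_le_one)
      fix A assume "A \<in> space \<mu>"
      then have "norm (g p A) * norm (g p A) \<le> norm (A $$ (fst p, snd p)) * norm (A $$ (fst p, snd p))"
        using g_le(1)[OF pq(1)] by (intro mult_mono) auto
      then show "norm (g p A * cnj (g q A)) \<le> (norm (A $$ (fst p, snd p)))\<^sup>2"
        using True swap by (auto simp: norm_mult power2_eq_square)
    qed
    also have "\<dots> = 1 / n"
      using pq by (intro integral_norm_entry_sq) (auto simp: off_diag_def)
    finally show ?thesis using True by simp
  next
    case False
    then show ?thesis
      using integral_entry_product_orthogonal[of "fst p" "snd p" "fst q" "snd q"] pq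
      by (auto simp: g_def prod_eq_iff)
  qed
  have "complex_of_real (\<integral>A. (norm (off_diag_sq A))\<^sup>2 \<partial>\<mu>)
      = (\<integral>A. complex_of_real ((norm (off_diag_sq A))\<^sup>2) \<partial>\<mu>)"
    by (simp only: integral_complex_of_real)
  also have "\<dots> = (\<integral>A. (\<Sum>p\<in>off_diag n. \<Sum>q\<in>off_diag n. g p A * cnj (g q A)) \<partial>\<mu>)"
    by (intro Bochner_Integration.integral_cong)
      (auto simp: off_diag_sq_def g_def complex_norm_square sum_product case_prod_unfold simp del: of_real_power)
  also have "\<dots> = (\<Sum>p\<in>off_diag n. \<Sum>q\<in>off_diag n. \<integral>A. g p A * cnj (g q A) \<partial>\<mu>)"
    using int by (subst Bochner_Integration.integral_sum)
      (auto intro!: Bochner_Integration.integrable_sum sum.cong Bochner_Integration.integral_sum)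
  finally have "(\<integral>A. (norm (off_diag_sq A))\<^sup>2 \<partial>\<mu>)
      \<le> norm (\<Sum>p\<in>off_diag n. \<Sum>q\<in>off_diag n. \<integral>A. g p A * cnj (g q A) \<partial>\<mu>)"
    by (metis abs_ge_self norm_of_real)
  also have "\<dots> \<le> (\<Sum>p\<in>off_diag n. \<Sum>q\<in>off_diag n. if q \<in> {p, prod.swap p} then 1 / n else 0)"
    using bound by (intro sum_norm_le order_trans[OF norm_sum] sum_mono) auto
  \<comment> \<open>The pairs are ordered, so a pair and its swap both count: hence the factor
    2.\<close>
  also have "\<dots> \<le> (\<Sum>p\<in>off_diag n. 2 / n)"
  proof (intro sum_mono)
    fix p assume "p \<in> off_diag n"
    have "(\<Sum>q\<in>off_diag n. if q \<in> {p, prod.swap p} then 1 / real n else 0)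
        = (\<Sum>q\<in>off_diag n \<inter> {p, prod.swap p}. 1 / real n)"
      by (intro sum.inter_restrict[symmetric]) auto
    also have "\<dots> \<le> (\<Sum>q\<in>{p, prod.swap p}. 1 / real n)"
      by (intro sum_mono2) auto
    also have "\<dots> \<le> 2 / n"
      by (cases "p = prod.swap p") (auto intro: divide_right_mono)
    finally show "(\<Sum>q\<in>off_diag n. if q \<in> {p, prod.swap p} then 1 / real n else 0) \<le> 2 / n" .
  qed
  also have "\<dots> = real (card (off_diag n)) * (2 / n)" by simp
  also have "\<dots> \<le> real (n * n) * (2 / n)"
    using card_off_diag_le[of n] by (intro mult_right_mono of_nat_mono) auto
  also have "\<dots> = 2 * n" using assms by simp
  finally show ?thesis by simp
qed

text \<open>Cauchy-Schwarz in the form x <= c/2 + x^2/(2c), with c equal to the bound on the root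
  mean square.\<close>

lemma integral_norm_off_diag_sq_le_sqrt:
  assumes "n \<ge> 1"
  shows "(\<integral>A. norm (off_diag_sq A) \<partial>\<mu>) \<le> sqrt (2 * n)"
proof -
  define c where "c = sqrt (2 * n)"
  have c: "c > 0" "c\<^sup>2 = 2 * n" using assms by (auto simp: c_def)
  have int: "integrable \<mu> (\<lambda>A. (norm (off_diag_sq A))\<^sup>2)"
    by (rule integrable_bounded[where B="(real (card (off_diag n)))\<^sup>2"])
      (auto intro!: power_mono norm_off_diag_sq_le)
  have "norm (\<integral>A. norm (off_diag_sq A) \<partial>\<mu>) \<le> (\<integral>A. c / 2 + (norm (off_diag_sq A))\<^sup>2 / (2 * c) \<partial>\<mu>)"
  proof (rule norm_integral_le)
    show "integrable \<mu> (\<lambda>A. norm (off_diag_sq A))"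
      by (rule integrable_bounded[where B="real (card (off_diag n))"]) (auto intro!: norm_off_diag_sq_le)
    fix A
    have "2 * c * norm (off_diag_sq A) \<le> c\<^sup>2 + (norm (off_diag_sq A))\<^sup>2"
      by (rule sum_squares_bound[of c "norm (off_diag_sq A)", simplified mult.assoc[symmetric]])
    then show "norm (norm (off_diag_sq A)) \<le> c / 2 + (norm (off_diag_sq A))\<^sup>2 / (2 * c)"
      using c(1) by (simp add: field_simps power2_eq_square)
  qed (use int in auto)
  also have "\<dots> = c / 2 + (\<integral>A. (norm (off_diag_sq A))\<^sup>2 \<partial>\<mu>) / (2 * c)"
    using int by simp
  also have "\<dots> \<le> c / 2 + c\<^sup>2 / (2 * c)"
    using integral_norm_off_diag_sq[OF assms] c by (intro add_left_mono divide_right_mono) auto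
  also have "\<dots> = c" using c(1) by (simp add: power2_eq_square)
  finally show ?thesis unfolding c_def by simp
qed

text \<open>The derivative at \<open>s = 0\<close> of the expectation of \<open>u\<^sub>j\<^sub>k exp (i Re (cnj z Tr U))\<close> under the
  one-parameter group of rotations of rows \<open>j\<close>, \<open>k\<close> with phase \<open>\<alpha>\<close>.\<close>

lemma integral_rotation_derivative:
  assumes jk: "j < n" "k < n" "j \<noteq> k" and \<alpha>: "\<alpha> * cnj \<alpha> = 1"
  shows "(\<integral>A. (\<alpha> * A $$ (k, k) + \<i> * A $$ (j, k) *
      Re (cnj z * (\<alpha> * A $$ (k, j) - cnj \<alpha> * A $$ (j, k)))) * plane_wave z (trace_mat A) \<partial>\<mu>) = 0"
proof -
  \<comment> \<open>This is the exponential of \<open>s\<close> times the skew-Hermitian matrix with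
    entry \<open>\<alpha>\<close> at \<open>(j, k)\<close> and \<open>- cnj \<alpha>\<close> at
    \<open>(k, j)\<close>; its square is minus the identity on the block because
    \<open>\<alpha>\<close> has modulus 1. The complex arguments of \<open>cos\<close> and
    \<open>sin\<close> allow complex differentiation rules.\<close>
  define V where "V s = row_mix n j k (cos (complex_of_real s)) (\<alpha> * sin (complex_of_real s)) (- cnj \<alpha> * sin (complex_of_real s)) (cos (complex_of_real s))" for s :: real
  have V: "V s \<in> unitary_group n" for s
  proof -
    have real: "cnj (cos (complex_of_real s)) = cos (complex_of_real s)"
        "cnj (sin (complex_of_real s)) = sin (complex_of_real s)"
      by (metis cos_of_real complex_cnj_complex_of_real) (metis sin_of_real complex_cnj_complex_of_real)
    have "cos (complex_of_real s) * cos (of_real s) + (\<alpha> * cnj \<alpha>) * (sin (of_real s) * sin (of_real s)) = 1"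
      unfolding \<alpha> using sin_cos_squared_add3[of "complex_of_real s"] by simp
    then show ?thesis unfolding V_def using jk
      by (intro row_mix_unitary) (simp_all add: real algebra_simps)
  qed
  have norm_\<alpha>: "norm \<alpha> = 1"
    using arg_cong[OF \<alpha>, of norm] norm_ge_zero[of \<alpha>]
    by (auto simp: norm_mult square_eq_1_iff simp del: norm_ge_zero)
  \<comment> \<open>\<open>w\<close> and \<open>u\<close> are the trace and the
    \<open>(j, k)\<close> entry of \<open>V s * A\<close>, written out so that the dependence on
    \<open>s\<close> is explicit; \<open>w'\<close> and \<open>u'\<close> are their
    derivatives.\<close>
  define w where "w s A = trace_mat A + (cos (complex_of_real s) - 1) * (A $$ (j, j) + A $$ (k, k))
      + sin (complex_of_real s) * (\<alpha> * A $$ (k, j) - cnj \<alpha> * A $$ (j, k))" for s :: real and A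
  define w' where "w' s A = - sin (complex_of_real s) * (A $$ (j, j) + A $$ (k, k))
      + cos (complex_of_real s) * (\<alpha> * A $$ (k, j) - cnj \<alpha> * A $$ (j, k))" for s :: real and A
  define u where "u s A = cos (complex_of_real s) * A $$ (j, k) + \<alpha> * sin (complex_of_real s) * A $$ (k, k)" for s :: real and A
  define u' where "u' s A = - sin (complex_of_real s) * A $$ (j, k) + \<alpha> * cos (complex_of_real s) * A $$ (k, k)" for s :: real and A
  define F where "F s A = u s A * plane_wave z (w s A)" for s A
  define F' where "F' s A = (u' s A + u s A * (\<i> * Re (cnj z * w' s A))) * plane_wave z (w s A)" for s A
  have [measurable]: "(\<lambda>A. A $$ (j, j)) \<in> borel_measurable \<mu>" "(\<lambda>A. A $$ (j, k)) \<in> borel_measurable \<mu>"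
    "(\<lambda>A. A $$ (k, j)) \<in> borel_measurable \<mu>" "(\<lambda>A. A $$ (k, k)) \<in> borel_measurable \<mu>"
    using jk by auto
  have F_eq: "F s A = F 0 (V s * A)" if "A \<in> unitary_group n" for s A
  proof -
    have "trace_mat (V s * A) = w s A"
      using trace_row_mix_mult[OF that jk, of "cos (of_real s)" "\<alpha> * sin (of_real s)" "- cnj \<alpha> * sin (of_real s)" "cos (of_real s)"] V[of s]
      by (simp add: V_def w_def algebra_simps)
    moreover have "(V s * A) $$ (j, k) = u s A"
      using row_mix_mult_index[OF unitary_group_carrier[OF that] jk(1,2) jk(1,2)]
      by (simp add: V_def u_def)
    ultimately show ?thesis by (simp add: F_def u_def w_def)
  qed
  have le: "norm (A $$ (j, j)) \<le> 1" "norm (A $$ (j, k)) \<le> 1" "norm (A $$ (k, j)) \<le> 1" "norm (A $$ (k, k)) \<le> 1"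
    if "A \<in> unitary_group n" for A
    using that jk by (auto intro: unitary_norm_entry_le)
  have comb: "norm (x * a + y * b) \<le> norm a + norm b" if "norm x \<le> 1" "norm y \<le> 1" for x y a b :: complex
    by (intro order_trans[OF norm_triangle_ineq] add_mono) (use that in \<open>auto simp: norm_mult intro!: mult_left_le_one_le\<close>)
  have trig: "norm (cos (complex_of_real s)) \<le> 1" "norm (sin (complex_of_real s)) \<le> 1" for s
    by (simp_all add: cos_of_real sin_of_real)
  have u_le: "norm (u s A) \<le> 2" "norm (u' s A) \<le> 2" if "A \<in> unitary_group n" for s A
    using comb[of "cos (of_real s)" "\<alpha> * sin (of_real s)" "A $$ (j, k)" "A $$ (k, k)"]
      comb[of "- sin (of_real s)" "\<alpha> * cos (of_real s)" "A $$ (j, k)" "A $$ (k, k)"]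
      trig[of s] le[OF that] norm_\<alpha>
    unfolding u_def u'_def by (simp_all add: norm_mult)
  have w_le: "norm (w' s A) \<le> 4" if "A \<in> unitary_group n" for s A
  proof -
    have "norm (\<alpha> * A $$ (k, j) - cnj \<alpha> * A $$ (j, k)) \<le> 2"
      using norm_triangle_ineq4[of "\<alpha> * A $$ (k, j)" "cnj \<alpha> * A $$ (j, k)"] norm_\<alpha> le[OF that]
      by (simp add: norm_mult)
    moreover have "norm (A $$ (j, j) + A $$ (k, k)) \<le> 2"
      using norm_triangle_ineq[of "A $$ (j, j)" "A $$ (k, k)"] le[OF that] by simp
    ultimately show ?thesis
      using comb[of "- sin (of_real s)" "cos (of_real s)"] trig[of s]
      unfolding w'_def by (smt (verit) norm_minus_cancel)
  qed
  have "((\<lambda>s. \<integral>A. F s A \<partial>\<mu>) has_vector_derivative (\<integral>A. F' 0 A \<partial>\<mu>)) (at 0)"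
  \<comment> \<open>The constant comes from the bounds 2 for \<open>u\<close> and \<open>u'\<close>
    and 4 for \<open>w'\<close>.\<close>
  proof (rule has_vector_derivative_lebesgue_integral[where C="2 + 8 * norm z"])
    show "finite_measure \<mu>" by unfold_locales
    show "((\<lambda>s. F s A) has_vector_derivative F' s A) (at s)" for s A
    proof -
      have u: "((\<lambda>s. u s A) has_vector_derivative u' s A) (at s)"
        unfolding u_def u'_def
        by (rule has_vector_derivative_real_field[where f="\<lambda>s. cos s * A $$ (j, k) + \<alpha> * sin s * A $$ (k, k)"])
          (auto intro!: derivative_eq_intros)
      have w: "((\<lambda>s. w s A) has_vector_derivative w' s A) (at s)"
        unfolding w_def w'_def
        by (rule has_vector_derivative_real_field[where f="\<lambda>s. trace_mat A + (cos s - 1) * (A $$ (j, j) + A $$ (k, k))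
            + sin s * (\<alpha> * A $$ (k, j) - cnj \<alpha> * A $$ (j, k))"])
          (auto intro!: derivative_eq_intros)
      show ?thesis
        unfolding F_def F'_def
        by (rule has_vector_derivative_eq_rhs[OF has_vector_derivative_mult[OF u has_vector_derivative_plane_wave[OF w]]])
          (simp add: algebra_simps)
    qed
    show "norm (F' s A) \<le> 2 + 8 * norm z" if "A \<in> space \<mu>" for s A
    proof -
      have A: "A \<in> unitary_group n" using that by simp
      have "\<bar>Re (cnj z * w' s A)\<bar> \<le> norm z * norm (w' s A)"
        using abs_Re_le_cmod[of "cnj z * w' s A"] by (simp add: norm_mult)
      also have "\<dots> \<le> norm z * 4" using w_le[OF A] by (intro mult_left_mono) auto
      finally have "norm (u s A) * \<bar>Re (cnj z * w' s A)\<bar> \<le> 2 * (norm z * 4)"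
        using u_le[OF A] by (intro mult_mono) auto
      moreover have "norm (F' s A) = norm (u' s A + u s A * (\<i> * Re (cnj z * w' s A)))"
        by (simp only: F'_def norm_mult norm_plane_wave mult_1_right)
      moreover have "norm (u s A * (\<i> * Re (cnj z * w' s A))) = norm (u s A) * \<bar>Re (cnj z * w' s A)\<bar>"
        by (simp only: norm_mult norm_ii norm_of_real mult_1_left)
      ultimately show ?thesis
        using norm_triangle_ineq[of "u' s A" "u s A * (\<i> * Re (cnj z * w' s A))"] u_le(2)[OF A, of s]
        by linarith
    qed
    show "integrable \<mu> (F s)" for s
      using u_le(1) unfolding F_def u_def w_def
      by (intro integrable_bounded[where B=2]) (auto simp: norm_mult)
    show "F' 0 \<in> borel_measurable \<mu>"
      unfolding F'_def u_def u'_def w_def w'_def by measurable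
  qed
  \<comment> \<open>By invariance the expectation does not depend on \<open>s\<close>, so its
    derivative at 0 vanishes.\<close>
  moreover have "(\<lambda>s. \<integral>A. F s A \<partial>\<mu>) = (\<lambda>_. \<integral>A. F 0 A \<partial>\<mu>)"
  proof
    fix s
    have "(\<integral>A. F s A \<partial>\<mu>) = (\<integral>A. F 0 (V s * A) \<partial>\<mu>)"
      using F_eq by (intro Bochner_Integration.integral_cong) auto
    also have "\<dots> = (\<integral>A. F 0 A \<partial>\<mu>)"
      by (rule integral_mult[OF V]) (unfold F_def u_def w_def, measurable)
    finally show "(\<integral>A. F s A \<partial>\<mu>) = (\<integral>A. F 0 A \<partial>\<mu>)" .
  qed
  ultimately have "((\<lambda>s. \<integral>A. F 0 A \<partial>\<mu>) has_vector_derivative (\<integral>A. F' 0 A \<partial>\<mu>)) (at (0::real))"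
    by (simp only:)
  then have "(\<integral>A. F' 0 A \<partial>\<mu>) = 0"
    using vector_derivative_unique_at[OF _ has_vector_derivative_const] by blast
  then show ?thesis
    by (simp add: F'_def u_def u'_def w_def w'_def mult_ac)
qed

end

section \<open>The Schwinger-Dyson equation\<close>

context haar_unitary
begin

text \<open>Closed under every operation in the integrands below, so that their integrability
  reduces to introduction rules.\<close>

definition bounded_measurable :: "(complex mat \<Rightarrow> complex) \<Rightarrow> bool" where
  "bounded_measurable F \<longleftrightarrow> F \<in> borel_measurable \<mu> \<and> (\<exists>B. \<forall>A\<in>unitary_group n. norm (F A) \<le> B)"

lemma bounded_measurableI:
  "F \<in> borel_measurable \<mu> \<Longrightarrow> (\<And>A. A \<in> unitary_group n \<Longrightarrow> norm (F A) \<le> B) \<Longrightarrow> bounded_measurable F"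
  by (auto simp: bounded_measurable_def)

lemma integrable_bounded_measurable: "bounded_measurable F \<Longrightarrow> integrable \<mu> F"
  unfolding bounded_measurable_def using integrable_bounded by blast

lemma bounded_measurable_const: "bounded_measurable (\<lambda>_. c)"
  by (rule bounded_measurableI[where B="norm c"]) auto

lemma bounded_measurable_entry: "i < n \<Longrightarrow> j < n \<Longrightarrow> bounded_measurable (\<lambda>A. A $$ (i, j))"
  by (rule bounded_measurableI[where B=1]) (auto intro: unitary_norm_entry_le)

lemma bounded_measurable_trace: "bounded_measurable trace_mat"
  by (rule bounded_measurableI[OF measurable_trace norm_trace_le])

lemma bounded_measurable_off_diag_sq: "bounded_measurable off_diag_sq"
  by (rule bounded_measurableI[OF measurable_off_diag_sq norm_off_diag_sq_le])

lemma bounded_measurable_plane_wave: "bounded_measurable (\<lambda>A. plane_wave z (trace_mat A))"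
  by (rule bounded_measurableI[where B=1]) auto

lemma bounded_measurable_cnj:
  "bounded_measurable F \<Longrightarrow> bounded_measurable (\<lambda>A. cnj (F A))"
  by (auto simp: bounded_measurable_def)

lemma bounded_measurable_add:
  assumes "bounded_measurable F" "bounded_measurable G"
  shows "bounded_measurable (\<lambda>A. F A + G A)"
proof -
  obtain B C where "\<forall>A\<in>unitary_group n. norm (F A) \<le> B" "\<forall>A\<in>unitary_group n. norm (G A) \<le> C"
    and "F \<in> borel_measurable \<mu>" "G \<in> borel_measurable \<mu>"
    using assms by (auto simp: bounded_measurable_def)
  then show ?thesis
    by (intro bounded_measurableI[where B="B + C"]) (auto intro: norm_triangle_mono)
qed

lemma bounded_measurable_mult:
  assumes "bounded_measurable F" "bounded_measurable G"
  shows "bounded_measurable (\<lambda>A. F A * G A)"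
proof -
  obtain B C where "\<forall>A\<in>unitary_group n. norm (F A) \<le> B" "\<forall>A\<in>unitary_group n. norm (G A) \<le> C"
    and "F \<in> borel_measurable \<mu>" "G \<in> borel_measurable \<mu>"
    using assms by (auto simp: bounded_measurable_def)
  then show ?thesis
    by (intro bounded_measurableI[where B="\<bar>B\<bar> * \<bar>C\<bar>"])
      (auto simp: norm_mult intro!: mult_mono elim!: ballE order_trans)
qed

lemma bounded_measurable_diff:
  assumes "bounded_measurable F" "bounded_measurable G"
  shows "bounded_measurable (\<lambda>A. F A - G A)"
  using bounded_measurable_add[OF assms(1) bounded_measurable_mult[OF bounded_measurable_const[of "-1"] assms(2)]]
  by simp

lemma bounded_measurable_Re:
  assumes "bounded_measurable F"
  shows "bounded_measurable (\<lambda>A. of_real (Re (F A)))"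
proof -
  obtain B where "\<forall>A\<in>unitary_group n. norm (F A) \<le> B" "F \<in> borel_measurable \<mu>"
    using assms by (auto simp: bounded_measurable_def)
  then show ?thesis
    by (intro bounded_measurableI[where B=B]) (auto intro: order_trans[OF abs_Re_le_cmod])
qed

lemma bounded_measurable_sum:
  "finite I \<Longrightarrow> (\<And>i. i \<in> I \<Longrightarrow> bounded_measurable (F i)) \<Longrightarrow> bounded_measurable (\<lambda>A. \<Sum>i\<in>I. F i A)"
  by (induction I rule: finite_induct) (auto intro: bounded_measurable_const bounded_measurable_add)

lemmas bounded_measurable_intros =
  bounded_measurable_const bounded_measurable_entry bounded_measurable_trace
  bounded_measurable_off_diag_sq bounded_measurable_plane_wave bounded_measurable_cnj
  bounded_measurable_add bounded_measurable_diff bounded_measurable_mult bounded_measurable_Re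
  bounded_measurable_sum

text \<open>The two real rotations, with phases \<open>1\<close> and \<open>\<i>\<close>, combine to the derivative along the
  elementary matrix \<open>E\<^sub>j\<^sub>k\<close> of the complexified Lie algebra.\<close>

lemma schwinger_dyson:
  assumes jk: "j < n" "k < n" "j \<noteq> k"
  shows "(\<integral>A. A $$ (k, k) * plane_wave z (trace_mat A) \<partial>\<mu>) =
    (\<integral>A. \<i> / 2 * (A $$ (j, k) * (z * cnj (A $$ (j, k)) - cnj z * A $$ (k, j)) * plane_wave z (trace_mat A)) \<partial>\<mu>)"
    (is "integral\<^sup>L \<mu> ?L = integral\<^sup>L \<mu> ?R")
proof -
  define X where "X \<alpha> A = (\<alpha> * A $$ (k, k) + \<i> * A $$ (j, k) *
      Re (cnj z * (\<alpha> * A $$ (k, j) - cnj \<alpha> * A $$ (j, k)))) * plane_wave z (trace_mat A)" for \<alpha> A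
  have X: "(\<integral>A. X \<alpha> A \<partial>\<mu>) = 0" if "\<alpha> * cnj \<alpha> = 1" for \<alpha>
    unfolding X_def by (rule integral_rotation_derivative[OF jk that])
  have bm: "bounded_measurable (X \<alpha>)" for \<alpha>
    unfolding X_def using jk by (intro bounded_measurable_intros)
  \<comment> \<open>\<open>X\<close> is real-linear in \<open>\<alpha>\<close>; this combination
    extracts the coefficient of its complex-linear part.\<close>
  have eq: "?L A - ?R A = (X 1 A - \<i> * X \<i> A) / 2" for A
  proof -
    define p q where "p = cnj z * A $$ (k, j)" and "q = cnj z * A $$ (j, k)"
    have Re: "Re (cnj z * (1 * A $$ (k, j) - cnj 1 * A $$ (j, k))) = Re (p - q)"
      "Re (cnj z * (\<i> * A $$ (k, j) - cnj \<i> * A $$ (j, k))) = - Im (p + q)"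
      by (simp_all add: p_def q_def algebra_simps)
    have pq: "complex_of_real (Re (p - q)) + \<i> * complex_of_real (Im (p + q)) = p - cnj q"
      by (simp add: complex_eq_iff)
    have "(X 1 A - \<i> * X \<i> A) / 2 = (A $$ (k, k) + \<i> / 2 * A $$ (j, k) *
        (complex_of_real (Re (p - q)) + \<i> * complex_of_real (Im (p + q)))) * plane_wave z (trace_mat A)"
      unfolding X_def Re by (simp add: field_simps)
    also have "\<dots> = ?L A - ?R A"
      unfolding pq by (simp add: p_def q_def field_simps)
    finally show ?thesis by simp
  qed
  have "integral\<^sup>L \<mu> ?L - integral\<^sup>L \<mu> ?R = (\<integral>A. ?L A - ?R A \<partial>\<mu>)"
    using jk by (intro Bochner_Integration.integral_diff[symmetric] integrable_bounded_measurable bounded_measurable_intros)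
  also have "\<dots> = (\<integral>A. (X 1 A - \<i> * X \<i> A) / 2 \<partial>\<mu>)"
    unfolding eq ..
  also have "\<dots> = ((\<integral>A. X 1 A \<partial>\<mu>) - \<i> * (\<integral>A. X \<i> A \<partial>\<mu>)) / 2"
    using integrable_bounded_measurable[OF bm] by simp
  also have "\<dots> = 0" by (simp add: X)
  finally show ?thesis by simp
qed

text \<open>Each \<open>k\<close> lies in \<open>n - 1\<close> pairs, while the full columns
  contribute \<open>n\<close> on the right. The error thus consists of one surplus expectation of
  the plane wave, the diagonal squares \<open>D\<close>, whose expectation is 1, and
  \<open>off_diag_sq\<close>; these give the summands 1, 1 and \<open>sqrt (2 * n)\<close>.\<close>

lemma integral_trace_plane_wave:
  assumes "n \<ge> 1"
  shows "norm ((\<integral>A. trace_mat A * plane_wave z (trace_mat A) \<partial>\<mu>)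
      - \<i> / 2 * z * (\<integral>A. plane_wave z (trace_mat A) \<partial>\<mu>)) * (n - 1) \<le> norm z / 2 * (sqrt (2 * n) + 2)"
proof -
  let ?G = "\<lambda>A. plane_wave z (trace_mat A)"
  define D where "D A = (\<Sum>k<n. A $$ (k, k) * cnj (A $$ (k, k)))" for A :: "complex mat"
  have D_eq: "D A = complex_of_real (\<Sum>k<n. (norm (A $$ (k, k)))\<^sup>2)" for A
    by (simp only: D_def of_real_sum complex_norm_square)
  have bm_D: "bounded_measurable D"
    unfolding D_def by (intro bounded_measurable_intros) auto
  note int = integrable_bounded_measurable
  note bm = bounded_measurable_intros bm_D
  have "of_nat (n - 1) * (\<integral>A. trace_mat A * ?G A \<partial>\<mu>) = (\<integral>A. of_nat (n - 1) * (trace_mat A * ?G A) \<partial>\<mu>)"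
    by simp
  also have "\<dots> = (\<integral>A. (\<Sum>(j, k)\<in>off_diag n. A $$ (k, k) * ?G A) \<partial>\<mu>)"
    using assms
    by (intro Bochner_Integration.integral_cong)
      (auto simp: sum_off_diag unitary_trace_eq of_nat_diff sum_distrib_right sum_distrib_left algebra_simps simp flip: sum.distrib)
  also have "\<dots> = (\<Sum>(j, k)\<in>off_diag n. \<integral>A. A $$ (k, k) * ?G A \<partial>\<mu>)"
    unfolding case_prod_unfold
    by (intro Bochner_Integration.integral_sum int bm) (auto simp: off_diag_def)
  also have "\<dots> = (\<Sum>(j, k)\<in>off_diag n.
      \<integral>A. \<i> / 2 * (A $$ (j, k) * (z * cnj (A $$ (j, k)) - cnj z * A $$ (k, j)) * ?G A) \<partial>\<mu>)"
    unfolding case_prod_unfold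
    by (intro sum.cong refl schwinger_dyson) (auto simp: off_diag_def)
  also have "\<dots> = (\<integral>A. (\<Sum>(j, k)\<in>off_diag n.
       \<i> / 2 * (A $$ (j, k) * (z * cnj (A $$ (j, k)) - cnj z * A $$ (k, j)) * ?G A)) \<partial>\<mu>)"
    unfolding case_prod_unfold
    by (intro Bochner_Integration.integral_sum[symmetric] int bm) (auto simp: off_diag_def)
  also have "\<dots> = (\<integral>A. \<i> / 2 * (z * (of_nat n * ?G A) - z * (D A * ?G A) - cnj z * (off_diag_sq A * ?G A)) \<partial>\<mu>)"
  proof (intro Bochner_Integration.integral_cong refl)
    fix A assume "A \<in> space \<mu>"
    then have A: "A \<in> unitary_group n" by simp
    have "(\<Sum>(j, k)\<in>off_diag n. A $$ (j, k) * cnj (A $$ (j, k)))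
        = (\<Sum>k<n. \<Sum>j<n. A $$ (j, k) * cnj (A $$ (j, k))) - D A"
      unfolding D_def by (rule sum_off_diag)
    also have "(\<Sum>k<n. \<Sum>j<n. A $$ (j, k) * cnj (A $$ (j, k))) = (\<Sum>k<n. complex_of_real (\<Sum>j<n. (norm (A $$ (j, k)))\<^sup>2))"
      by (simp only: of_real_sum complex_norm_square)
    also have "\<dots> = of_nat n"
      using unitary_sum_col[OF A] by simp
    finally have sum1: "(\<Sum>(j, k)\<in>off_diag n. A $$ (j, k) * cnj (A $$ (j, k))) = of_nat n - D A" .
    have "(\<Sum>(j, k)\<in>off_diag n. \<i> / 2 * (A $$ (j, k) * (z * cnj (A $$ (j, k)) - cnj z * A $$ (k, j)) * ?G A))
      = (\<i> / 2 * z * ?G A) * (\<Sum>(j, k)\<in>off_diag n. A $$ (j, k) * cnj (A $$ (j, k)))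
        - (\<i> / 2 * cnj z * ?G A) * (\<Sum>(j, k)\<in>off_diag n. A $$ (j, k) * A $$ (k, j))"
      unfolding sum_distrib_left sum_subtractf[symmetric]
      by (intro sum.cong) (auto simp: algebra_simps)
    also have "\<dots> = \<i> / 2 * (z * (of_nat n * ?G A) - z * (D A * ?G A) - cnj z * (off_diag_sq A * ?G A))"
      unfolding sum1 off_diag_sq_def[symmetric] by (simp add: field_simps)
    finally show "(\<Sum>(j, k)\<in>off_diag n. \<i> / 2 * (A $$ (j, k) * (z * cnj (A $$ (j, k)) - cnj z * A $$ (k, j)) * ?G A))
      = \<i> / 2 * (z * (of_nat n * ?G A) - z * (D A * ?G A) - cnj z * (off_diag_sq A * ?G A))" .
  qed
  also have "\<dots> = \<i> / 2 * (z * (of_nat n * (\<integral>A. ?G A \<partial>\<mu>)) - z * (\<integral>A. D A * ?G A \<partial>\<mu>)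
      - cnj z * (\<integral>A. off_diag_sq A * ?G A \<partial>\<mu>))"
    using int[OF bounded_measurable_mult[OF bm_D bounded_measurable_plane_wave]]
      int[OF bounded_measurable_mult[OF bounded_measurable_off_diag_sq bounded_measurable_plane_wave]]
      int[OF bounded_measurable_plane_wave]
    by simp
  finally have main: "of_nat (n - 1) * (\<integral>A. trace_mat A * ?G A \<partial>\<mu>) = \<dots>" .
  have "((\<integral>A. trace_mat A * ?G A \<partial>\<mu>) - \<i> / 2 * z * (\<integral>A. ?G A \<partial>\<mu>)) * of_nat (n - 1)
    = of_nat (n - 1) * (\<integral>A. trace_mat A * ?G A \<partial>\<mu>) - \<i> / 2 * z * (\<integral>A. ?G A \<partial>\<mu>) * of_nat (n - 1)"
    by (simp only: left_diff_distrib right_diff_distrib mult.commute)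
  also have "\<dots> = \<i> / 2 * (z * (\<integral>A. ?G A \<partial>\<mu>) - z * (\<integral>A. D A * ?G A \<partial>\<mu>) - cnj z * (\<integral>A. off_diag_sq A * ?G A \<partial>\<mu>))"
    unfolding main using assms by (simp add: of_nat_diff field_simps)
  finally have eq: "((\<integral>A. trace_mat A * ?G A \<partial>\<mu>) - \<i> / 2 * z * (\<integral>A. ?G A \<partial>\<mu>)) * of_nat (n - 1)
    = \<i> / 2 * (z * (\<integral>A. ?G A \<partial>\<mu>) - z * (\<integral>A. D A * ?G A \<partial>\<mu>) - cnj z * (\<integral>A. off_diag_sq A * ?G A \<partial>\<mu>))" .
  have n1: "real n - 1 = real (n - 1)" using assms by (simp add: of_nat_diff)
  from arg_cong[OF eq, of norm]
  have "norm ((\<integral>A. trace_mat A * ?G A \<partial>\<mu>) - \<i> / 2 * z * (\<integral>A. ?G A \<partial>\<mu>)) * (n - 1)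
    = norm (\<i> / 2 * (z * (\<integral>A. ?G A \<partial>\<mu>) - z * (\<integral>A. D A * ?G A \<partial>\<mu>) - cnj z * (\<integral>A. off_diag_sq A * ?G A \<partial>\<mu>)))"
    unfolding n1 by (simp only: norm_mult norm_of_nat)
  also have "\<dots> = norm (z * (\<integral>A. ?G A \<partial>\<mu>) - z * (\<integral>A. D A * ?G A \<partial>\<mu>) - cnj z * (\<integral>A. off_diag_sq A * ?G A \<partial>\<mu>)) / 2"
    by (simp add: norm_mult norm_divide)
  also have "\<dots> \<le> (norm z * 1 + norm z * 1 + norm z * sqrt (2 * n)) / 2"
  proof (intro divide_right_mono norm_triangle_le_diff add_mono)
    have "norm (\<integral>A. ?G A \<partial>\<mu>) \<le> (\<integral>A. 1 \<partial>\<mu>)"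
      by (intro norm_integral_le int bounded_measurable_plane_wave) auto
    then show "norm (z * (\<integral>A. ?G A \<partial>\<mu>)) \<le> norm z * 1"
      unfolding norm_mult by (intro mult_left_mono) auto
    have int_sq: "integrable \<mu> (\<lambda>A. (norm (A $$ (k, k)))\<^sup>2)" if "k < n" for k
      using that unitary_norm_entry_le[of _ n k k]
      by (intro integrable_bounded[where B=1] borel_measurable_power borel_measurable_norm measurable_entry)
        (auto simp: power_le_one)
    have "norm (\<integral>A. D A * ?G A \<partial>\<mu>) \<le> (\<integral>A. (\<Sum>k<n. (norm (A $$ (k, k)))\<^sup>2) \<partial>\<mu>)"
    proof (intro norm_integral_le int bm)
      show "norm (D A * ?G A) \<le> (\<Sum>k<n. (norm (A $$ (k, k)))\<^sup>2)" for A
        by (simp add: norm_mult D_eq sum_nonneg del: of_real_sum)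
    qed (use int_sq in auto)
    also have "\<dots> = (\<Sum>k<n. \<integral>A. (norm (A $$ (k, k)))\<^sup>2 \<partial>\<mu>)"
      using int_sq by (intro Bochner_Integration.integral_sum) auto
    also have "\<dots> = 1" using assms by (simp add: integral_norm_entry_sq)
    finally show "norm (z * (\<integral>A. D A * ?G A \<partial>\<mu>)) \<le> norm z * 1"
      unfolding norm_mult by (intro mult_left_mono) auto
    have "norm (\<integral>A. off_diag_sq A * ?G A \<partial>\<mu>) \<le> (\<integral>A. norm (off_diag_sq A) \<partial>\<mu>)"
      by (intro norm_integral_le int bm integrable_norm) (auto simp: norm_mult)
    then show "norm (cnj z * (\<integral>A. off_diag_sq A * ?G A \<partial>\<mu>)) \<le> norm z * sqrt (2 * n)"
      using integral_norm_off_diag_sq_le_sqrt[OF assms] unfolding norm_mult complex_mod_cnj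
      by (intro mult_left_mono) auto
  qed auto
  finally show ?thesis by (simp add: algebra_simps add_divide_distrib)
qed

end

section \<open>The characteristic function of the trace\<close>

lemma plane_wave_scale: "plane_wave (of_real s * z) w = plane_wave z (of_real s * w)"
  by (simp add: plane_wave_def mult_ac)

lemma cnj_plane_wave: "cnj (plane_wave z w) = plane_wave (- z) w"
  by (simp add: plane_wave_def cis_cnj)

context haar_unitary
begin

abbreviation char_trace :: "complex \<Rightarrow> complex" where
  "char_trace z \<equiv> \<integral>A. plane_wave z (trace_mat A) \<partial>\<mu>"

text \<open>The first integral is the derivative of \<open>char_trace (of_real s * z)\<close> in
  \<open>s\<close>. Its real part splits into the trace and the conjugate trace, and the conjugate
  half is the conjugate of the first kind at the opposite frequency. Restricting \<open>s\<close> to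
  the unit interval makes the error uniform.\<close>

lemma char_trace_derivative_bound:
  assumes n: "n \<ge> 2" and s: "0 \<le> s" "s \<le> 1"
  shows "norm ((\<integral>A. \<i> * Re (cnj z * trace_mat A) * plane_wave (of_real s * z) (trace_mat A) \<partial>\<mu>)
    + of_real (s * (norm z)\<^sup>2 / 2) * char_trace (of_real s * z))
    \<le> (norm z)\<^sup>2 / 2 * ((sqrt (2 * n) + 2) / (n - 1))"
proof -
  define K where "K = (sqrt (2 * n) + 2) / (real n - 1)"
  define w where "w = of_real s * z"
  define m where "m w = (\<integral>A. trace_mat A * plane_wave w (trace_mat A) \<partial>\<mu>)" for w
  define E where "E w = m w - \<i> / 2 * w * char_trace w" for w
  have E: "norm (E w) \<le> norm w / 2 * K" for w
  proof -
    have "norm (E w) * (real n - 1) \<le> norm w / 2 * (sqrt (2 * n) + 2)"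
      using integral_trace_plane_wave[of w] n by (simp add: E_def m_def of_nat_diff)
    then show ?thesis using n by (simp add: K_def field_simps)
  qed
  have cnj_m: "(\<integral>A. cnj (trace_mat A) * plane_wave w (trace_mat A) \<partial>\<mu>) = cnj (m (- w))" for w
    by (simp only: m_def Bochner_Integration.integral_cnj[symmetric] complex_cnj_mult cnj_plane_wave minus_minus)
  have cnj_char: "cnj (char_trace (- w)) = char_trace w" for w
    by (simp only: Bochner_Integration.integral_cnj[symmetric] cnj_plane_wave minus_minus)
  have cnj_m': "cnj (m (- w)) = cnj (E (- w)) + \<i> / 2 * cnj w * char_trace w" for w
  proof -
    have "m (- w) = E (- w) + \<i> / 2 * (- w) * char_trace (- w)" by (simp add: E_def)
    then have "cnj (m (- w)) = cnj (E (- w)) + cnj (\<i> / 2 * (- w)) * cnj (char_trace (- w))"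
      by simp
    then show ?thesis unfolding cnj_char by simp
  qed
  have "(\<integral>A. \<i> * Re (cnj z * trace_mat A) * plane_wave w (trace_mat A) \<partial>\<mu>)
    = (\<integral>A. \<i> / 2 * (cnj z * (trace_mat A * plane_wave w (trace_mat A))
        + z * (cnj (trace_mat A) * plane_wave w (trace_mat A))) \<partial>\<mu>)"
  proof (intro Bochner_Integration.integral_cong refl)
    fix A
    have "complex_of_real (Re (cnj z * trace_mat A)) = (cnj z * trace_mat A + z * cnj (trace_mat A)) / 2"
      using complex_add_cnj[of "cnj z * trace_mat A"] by (simp add: mult.commute)
    then show "\<i> * Re (cnj z * trace_mat A) * plane_wave w (trace_mat A)
      = \<i> / 2 * (cnj z * (trace_mat A * plane_wave w (trace_mat A))
        + z * (cnj (trace_mat A) * plane_wave w (trace_mat A)))"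
      by (simp only:) (simp add: algebra_simps)
  qed
  also have "\<dots> = \<i> / 2 * (cnj z * m w + z * cnj (m (- w)))"
    using integrable_bounded_measurable[OF bounded_measurable_mult[OF bounded_measurable_trace bounded_measurable_plane_wave]]
      integrable_bounded_measurable[OF bounded_measurable_mult[OF bounded_measurable_cnj[OF bounded_measurable_trace] bounded_measurable_plane_wave]]
    unfolding cnj_m[symmetric] by (simp add: m_def)
  also have "\<dots> = \<i> / 2 * (cnj z * E w + z * cnj (E (- w))) - of_real (s * (norm z)\<^sup>2 / 2) * char_trace w"
  proof -
    have zz: "z * cnj z = of_real ((norm z)\<^sup>2)" by (rule complex_norm_square[symmetric])
    have "m w = E w + \<i> / 2 * w * char_trace w" by (simp add: E_def)
    then have "\<i> / 2 * (cnj z * m w + z * cnj (m (- w))) = \<i> / 2 * (cnj z * E w + z * cnj (E (- w)))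
        + (\<i> * \<i>) / 2 * of_real s * (z * cnj z) * char_trace w"
      unfolding cnj_m' by (simp add: w_def algebra_simps)
    then show ?thesis unfolding zz by simp
  qed
  finally have "norm ((\<integral>A. \<i> * Re (cnj z * trace_mat A) * plane_wave w (trace_mat A) \<partial>\<mu>)
      + of_real (s * (norm z)\<^sup>2 / 2) * char_trace w)
    = norm (cnj z * E w + z * cnj (E (- w))) / 2"
    by (simp add: norm_mult)
  also have "\<dots> \<le> (norm z * norm (E w) + norm z * norm (E (- w))) / 2"
    by (intro divide_right_mono order_trans[OF norm_triangle_ineq]) (auto simp: norm_mult)
  also have "\<dots> \<le> (norm z * (norm z / 2 * K) + norm z * (norm z / 2 * K)) / 2"
  proof (intro divide_right_mono add_mono mult_left_mono)
    have "norm w \<le> norm z" using s by (simp add: w_def norm_mult mult_left_le_one_le)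
    moreover have "K \<ge> 0" using n by (simp add: K_def)
    ultimately have "norm w / 2 * K \<le> norm z / 2 * K" by (intro mult_right_mono) auto
    then show "norm (E w) \<le> norm z / 2 * K" "norm (E (- w)) \<le> norm z / 2 * K"
      using E[of w] E[of "- w"] by auto
  qed auto
  also have "\<dots> = (norm z)\<^sup>2 / 2 * K" by (simp add: power2_eq_square)
  finally show ?thesis using n by (simp add: w_def K_def of_nat_diff)
qed

text \<open>\<open>\<phi> s = char_trace (s z)\<close> almost satisfies the differential equation of the Gaussian, so the
  quotient of \<open>\<phi>\<close> by the Gaussian is nearly constant on \<open>[0, 1]\<close>.\<close>

lemma char_trace_bound:
  assumes n: "n \<ge> 2"
  shows "norm (char_trace z - exp (- (norm z)\<^sup>2 / 4)) \<le> (norm z)\<^sup>2 / 2 * ((sqrt (2 * n) + 2) / (n - 1))"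
proof -
  define B where "B = (norm z)\<^sup>2 / 2 * ((sqrt (2 * n) + 2) / (n - 1))"
  \<comment> \<open>The reciprocal of the Gaussian along the segment, so that the quotient becomes
    the product \<open>\<phi> s * e s\<close>.\<close>
  define e where "e s = complex_of_real (exp (s\<^sup>2 * (norm z)\<^sup>2 / 4))" for s
  define \<phi> where "\<phi> s = char_trace (of_real s * z)" for s
  define \<phi>' where "\<phi>' s = (\<integral>A. \<i> * Re (cnj z * trace_mat A) * plane_wave (of_real s * z) (trace_mat A) \<partial>\<mu>)" for s
  have \<phi>: "(\<phi> has_vector_derivative \<phi>' s) (at s)" for s
    unfolding \<phi>_def \<phi>'_def
  proof (rule has_vector_derivative_lebesgue_integral[where C="norm z * n"])
    show "finite_measure \<mu>" by unfold_locales
    show "((\<lambda>s. plane_wave (of_real s * z) (trace_mat A)) has_vector_derivative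
      \<i> * Re (cnj z * trace_mat A) * plane_wave (of_real s * z) (trace_mat A)) (at s)" for s A
      unfolding plane_wave_scale
      by (rule has_vector_derivative_plane_wave)
        (rule has_vector_derivative_eq_rhs, rule has_vector_derivative_real_field[where f="\<lambda>s. s * trace_mat A"],
          auto intro!: derivative_eq_intros)
    show "norm (\<i> * Re (cnj z * trace_mat A) * plane_wave (of_real s * z) (trace_mat A)) \<le> norm z * n"
      if "A \<in> space \<mu>" for s A
    proof -
      have "\<bar>Re (cnj z * trace_mat A)\<bar> \<le> norm z * norm (trace_mat A)"
        using abs_Re_le_cmod[of "cnj z * trace_mat A"] by (simp add: norm_mult)
      also have "\<dots> \<le> norm z * n" using that by (intro mult_left_mono norm_trace_le) auto
      finally show ?thesis
        by (simp only: norm_mult norm_ii norm_of_real norm_plane_wave mult_1_left mult_1_right)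
    qed
    show "integrable \<mu> (\<lambda>A. plane_wave (of_real s * z) (trace_mat A))" for s
      by (intro integrable_bounded_measurable bounded_measurable_intros)
  qed measurable
  have e: "(e has_vector_derivative of_real (s * (norm z)\<^sup>2 / 2) * e s) (at s)" for s
  proof -
    have "((\<lambda>s. exp (s\<^sup>2 * (norm z)\<^sup>2 / 4)) has_real_derivative s * (norm z)\<^sup>2 / 2 * exp (s\<^sup>2 * (norm z)\<^sup>2 / 4)) (at s)"
      by (auto intro!: derivative_eq_intros)
    from has_vector_derivative_of_real[OF this, where 'a=complex] show ?thesis
      by (simp add: e_def[abs_def])
  qed
  have h: "((\<lambda>s. \<phi> s * e s) has_vector_derivative e s * (\<phi>' s + of_real (s * (norm z)\<^sup>2 / 2) * \<phi> s)) (at s)" for s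
    by (rule has_vector_derivative_eq_rhs[OF has_vector_derivative_mult[OF \<phi> e]]) (simp add: algebra_simps)
  \<comment> \<open>On the unit interval \<open>e\<close> is largest at 1, and the factor
    \<open>norm (e 1)\<close> cancels at the end.\<close>
  have "norm (\<phi> 1 * e 1 - \<phi> 0 * e 0) \<le> (norm (e 1) * B) * norm (1 - 0 :: real)"
  proof (rule differentiable_bound[where S="{0..1}"])
    show "((\<lambda>s. \<phi> s * e s) has_derivative (\<lambda>t. t *\<^sub>R (e s * (\<phi>' s + of_real (s * (norm z)\<^sup>2 / 2) * \<phi> s)))) (at s within {0..1})" for s
      using h[of s] has_vector_derivative_at_within unfolding has_vector_derivative_def[symmetric] by blast
    show "onorm (\<lambda>t. t *\<^sub>R (e s * (\<phi>' s + of_real (s * (norm z)\<^sup>2 / 2) * \<phi> s))) \<le> norm (e 1) * B"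
      if "s \<in> {0..1}" for s
    proof -
      have "norm (e s) \<le> norm (e 1)"
        using that by (auto simp: e_def power_le_one intro!: mult_left_le_one_le)
      moreover have "norm (\<phi>' s + of_real (s * (norm z)\<^sup>2 / 2) * \<phi> s) \<le> B"
        unfolding \<phi>'_def \<phi>_def B_def using that n by (intro char_trace_derivative_bound) auto
      ultimately have "norm (e s * (\<phi>' s + of_real (s * (norm z)\<^sup>2 / 2) * \<phi> s)) \<le> norm (e 1) * B"
        unfolding norm_mult by (intro mult_mono) auto
      then show ?thesis by (simp only: onorm_scaleR_left bounded_linear_ident onorm_id mult_1_left)
    qed
  qed auto
  moreover have "\<phi> 0 * e 0 = 1"
    by (simp add: \<phi>_def e_def)
  moreover have "\<phi> 1 * e 1 - 1 = e 1 * (char_trace z - exp (- (norm z)\<^sup>2 / 4))"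
  proof -
    have "e 1 * complex_of_real (exp (- (norm z)\<^sup>2 / 4)) = 1"
      unfolding e_def of_real_mult[symmetric] exp_add[symmetric] by simp
    then show ?thesis by (simp add: \<phi>_def algebra_simps)
  qed
  ultimately have "norm (e 1) * norm (char_trace z - exp (- (norm z)\<^sup>2 / 4)) \<le> norm (e 1) * B"
    by (simp add: norm_mult)
  moreover have "norm (e 1) > 0" by (simp add: e_def)
  ultimately show ?thesis unfolding B_def[symmetric] by (simp only: mult_le_cancel_left_pos)
qed

end

section \<open>The Gaussian characteristic function and the limit theorem\<close>

lemma expectation_cis_normal:
  assumes "prob_space N" "distributed N lborel X (normal_density 0 (sqrt (1 / 2)))"
  shows "(\<integral>w. cis (a * X w) \<partial>N) = exp (- (a\<^sup>2) / 4)"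
proof -
  interpret prob_space N by fact
  \<comment> \<open>Standardizing turns the frequency \<open>a\<close> into
    \<open>a * \<sigma>\<close>, and \<open>(a * \<sigma>)\<^sup>2 / 2\<close> is
    \<open>a\<^sup>2 / 4\<close>.\<close>
  define \<sigma> :: real where "\<sigma> = sqrt (1 / 2)"
  have \<sigma>: "\<sigma> > 0" "\<sigma>\<^sup>2 = 1 / 2" by (simp_all add: \<sigma>_def)
  have dist: "distributed N lborel (\<lambda>w. (X w - 0) / \<sigma>) std_normal_density"
    using assms(2) normal_standard_normal_convert[OF \<sigma>(1), of X 0] by (simp add: \<sigma>_def)
  have [measurable]: "X \<in> borel_measurable N"
    using distributed_measurable[OF assms(2)] by simp
  have "complex_of_real (exp (- ((a * \<sigma>)\<^sup>2) / 2)) = char (distr N lborel (\<lambda>w. (X w - 0) / \<sigma>)) (a * \<sigma>)"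
    unfolding distributed_distr_eq_density[OF dist] char_std_normal_distribution ..
  also have "\<dots> = (\<integral>w. cis (a * X w) \<partial>N)"
    unfolding char_def using \<sigma>(1)
    by (subst integral_distr) (auto simp: cis_conv_exp mult_ac)
  finally show ?thesis using \<sigma> by (simp add: power_mult_distrib)
qed

text \<open>The wave is a function of the real part times a function of the imaginary part, so
  independence factors the expectation.\<close>

lemma expectation_plane_wave_standard_complex_normal:
  assumes "standard_complex_normal N \<xi>"
  shows "(\<integral>w. plane_wave z (\<xi> w) \<partial>N) = exp (- (norm z)\<^sup>2 / 4)"
proof -
  interpret prob_space N using assms by (simp add: standard_complex_normal_def)
  have [measurable]: "\<xi> \<in> borel_measurable N"
    using assms by (simp add: standard_complex_normal_def)
  have cis: "(\<lambda>x. cis (a * x)) \<in> borel_measurable borel" for a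
    by (intro borel_measurable_continuous_onI continuous_intros)
  have "indep_var borel ((\<lambda>x. cis (Re z * x)) \<circ> (\<lambda>w. Re (\<xi> w))) borel ((\<lambda>x. cis (Im z * x)) \<circ> (\<lambda>w. Im (\<xi> w)))"
    using assms cis by (intro indep_var_compose) (auto simp: standard_complex_normal_def)
  then have indep: "indep_var borel (\<lambda>w. cis (Re z * Re (\<xi> w))) borel (\<lambda>w. cis (Im z * Im (\<xi> w)))"
    by (simp add: o_def)
  have int: "integrable N (\<lambda>w. cis (a * f (\<xi> w)))" if "f \<in> borel_measurable borel" for a f
    using that measurable_compose[OF _ cis[of a], of "\<lambda>w. f (\<xi> w)" N]
    by (intro integrable_const_bound[where B=1]) auto
  have "(\<integral>w. plane_wave z (\<xi> w) \<partial>N) = (\<integral>w. cis (Re z * Re (\<xi> w)) * cis (Im z * Im (\<xi> w)) \<partial>N)"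
    by (simp add: plane_wave_def cis_mult)
  also have "\<dots> = (\<integral>w. cis (Re z * Re (\<xi> w)) \<partial>N) * (\<integral>w. cis (Im z * Im (\<xi> w)) \<partial>N)"
    by (rule indep_var_lebesgue_integral[OF indep int[of Re] int[of Im]]) auto
  also have "\<dots> = complex_of_real (exp (- ((Re z)\<^sup>2) / 4) * exp (- ((Im z)\<^sup>2) / 4))"
    using assms prob_space_axioms by (simp add: standard_complex_normal_def expectation_cis_normal)
  also have "\<dots> = exp (- (norm z)\<^sup>2 / 4)"
    unfolding exp_add[symmetric] cmod_power2 by (simp add: field_simps)
  finally show ?thesis .
qed

theorem theorem3p1:
  fixes M :: "nat \<Rightarrow> 'a measure" and U :: "nat \<Rightarrow> 'a \<Rightarrow> complex mat"
    and N :: "'b measure" and \<xi> :: "'b \<Rightarrow> complex"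
  assumes "\<And>n. n \<ge> 1 \<Longrightarrow> haar_unitary_random_matrix n (M n) (U n)"
    and "standard_complex_normal N \<xi>"
  shows "converges_in_distribution M (\<lambda>n \<omega>. trace_mat (U n \<omega>)) N \<xi>"
proof (rule converges_in_distribution_plane_wave)
  define \<mu> where "\<mu> n = distr (M n) (unitary_borel n) (U n)" for n
  have U: "U n \<in> measurable (M n) (unitary_borel n)" "prob_space (M n)" "haar_unitary (\<mu> n) n" if "n \<ge> 1" for n
    using assms(1)[OF that]
    by (auto simp: haar_unitary_random_matrix_def haar_unitary_def haar_unitary_axioms_def
        normalized_haar_unitary_def \<mu>_def)
  have trace: "trace_mat \<in> borel_measurable (unitary_borel n)" if "n \<ge> 1" for n
    using haar_unitary.measurable_trace[OF U(3)[OF that]] by (simp add: \<mu>_def)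
  show "\<forall>\<^sub>F n in sequentially. prob_space (M n) \<and> (\<lambda>\<omega>. trace_mat (U n \<omega>)) \<in> borel_measurable (M n) \<and>
      integrable (M n) (\<lambda>w. (norm (trace_mat (U n w)))\<^sup>2) \<and>
      (\<integral>w. (norm (trace_mat (U n w)))\<^sup>2 \<partial>M n) \<le> 1"
    \<comment> \<open>The hypothesis starts at dimension 1 and leaves \<open>M 0\<close> arbitrary,
      hence the eventual form of the criterion.\<close>
    using eventually_ge_at_top[of 1]
  proof eventually_elim
    case (elim n)
    interpret haar_unitary "\<mu> n" n by (rule U(3)[OF elim])
    have [measurable]: "trace_mat \<in> borel_measurable (unitary_borel n)" by (rule trace[OF elim])
    have sq: "(\<lambda>A. (norm (trace_mat A))\<^sup>2) \<in> borel_measurable (unitary_borel n)" by measurable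
    have "integrable (M n) (\<lambda>w. (norm (trace_mat (U n w)))\<^sup>2)"
      using integrable_norm_trace_sq integrable_distr_eq[OF U(1)[OF elim] sq] by (simp add: \<mu>_def)
    moreover have "(\<integral>w. (norm (trace_mat (U n w)))\<^sup>2 \<partial>M n) = 1"
      using integral_norm_trace_sq[OF elim] integral_distr[OF U(1)[OF elim] sq] by (simp add: \<mu>_def)
    ultimately show ?case
      using U(2)[OF elim] measurable_compose[OF U(1)[OF elim] trace[OF elim]] by simp
  qed
  show "prob_space N" "\<xi> \<in> borel_measurable N"
    using assms(2) by (auto simp: standard_complex_normal_def)
  show "(\<lambda>n. \<integral>w. plane_wave z (trace_mat (U n w)) \<partial>M n) \<longlonglongrightarrow> (\<integral>w. plane_wave z (\<xi> w) \<partial>N)" for z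
    unfolding expectation_plane_wave_standard_complex_normal[OF assms(2)]
  proof (rule LIM_zero_cancel, rule Lim_null_comparison)
    show "\<forall>\<^sub>F n in sequentially. norm ((\<integral>w. plane_wave z (trace_mat (U n w)) \<partial>M n) - exp (- (norm z)\<^sup>2 / 4))
        \<le> (norm z)\<^sup>2 / 2 * ((sqrt (2 * real n) + 2) / (real n - 1))"
      \<comment> \<open>From dimension 2 on the divisor \<open>n - 1\<close> is positive.\<close>
      using eventually_ge_at_top[of 2]
    proof eventually_elim
      case (elim n)
      then have n: "n \<ge> 1" by simp
      have [measurable]: "trace_mat \<in> borel_measurable (unitary_borel n)" by (rule trace[OF n])
      have "(\<lambda>A. plane_wave z (trace_mat A)) \<in> borel_measurable (unitary_borel n)" by measurable
      from integral_distr[OF U(1)[OF n] this] show ?case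
        using haar_unitary.char_trace_bound[OF U(3)[OF n] elim, of z] n
        by (simp add: \<mu>_def of_nat_diff)
    qed
    have "(\<lambda>n. (sqrt (2 * real n) + 2) / (real n - 1)) \<longlonglongrightarrow> 0"
      by real_asymp
    then show "(\<lambda>n. (norm z)\<^sup>2 / 2 * ((sqrt (2 * real n) + 2) / (real n - 1))) \<longlonglongrightarrow> 0"
      by (rule tendsto_mult_right_zero)
  qed
qed

end
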